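(* Let $n\ge1$, let $S\in C^\infty(\mathbb{R}^n\times\mathbb{R}^n)$ be real-valued, let $\psi\in C^\infty_{\mathrm{comp}}(\mathbb{R}^n\times\mathbb{R}^n)$, let $\beta,\bar\beta\in C^\infty(\mathbb{R})$ be supported in $[\tfrac12,2]$ and $[-2,2]$ respectively, and put $h(x,\vartheta)=\det S_{x\vartheta}(x,\vartheta)$. For $\lambda\ge1$ and $\hbar>0$ let $$T_\lambda^{\pm\hbar}u(x)=\int_{\mathbb{R}^n}e^{i\lambda S(x,\vartheta)}\psi(x,\vartheta)\beta(\pm\hbar^{-1}h(x,\vartheta))u(\vartheta)\,d\vartheta,$$ $$\bar T_\lambda^{\hbar}u(x)=\int_{\mathbb{R}^n}e^{i\lambda S(x,\vartheta)}\psi(x,\vartheta)\bar\beta(\hbar^{-1}h(x,\vartheta))u(\vartheta)\,d\vartheta.$$ Assume that $\operatorname{rank}S_{x\vartheta}\ge n-1$, that the projection $\pi_L$ is of type at most $l$ and that the projection $\pi_R$ is of type at most $r$, where $l,r\ge1$ are integers. Then there is a constant $C$ independent of $\lambda$ and $\hbar$ such that $$\|T_\lambda^{\pm\hbar}\|_{L^1\to L^1}\le C\hbar^{\frac1r},\qquad \|T_\lambda^{\pm\hbar}\|_{L^\infty\to L^\infty}\le C\hbar^{\frac1l},$$ and the same estimates hold for $\bar T_\lambda^{\hbar}$: $$\|\bar T_\lambda^{\hbar}\|_{L^1\to L^1}\le C\hbar^{\frac1r},\qquad \|\bar T_\lambda^{\hbar}\|_{L^\infty\to L^\infty}\le C\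hbar^{\frac1l}.$$
   Context: $S_{x\vartheta}$ is the matrix of mixed second derivatives of $S$. The projections are $\pi_L:(x,\vartheta)\mapsto(x,S_x(x,\vartheta))$ and $\pi_R:(x,\vartheta)\mapsto(\vartheta,S_\vartheta(x,\vartheta))$. Type of a map: let $\pi:M\to N$ be a smooth map between smooth manifolds of the same dimension, of corank at most $1$, such that $\det d\pi$ vanishes simply on the critical set $\Sigma=\{\det d\pi=0\}\subset M$ (i.e. the differential of $\det d\pi$, computed in local coordinates, is nonzero at points of $\Sigma$). Let $V$ be any smooth vector field which locally generates the kernel of $d\pi$ on $\Sigma$: $V|_\Sigma\in\ker d\pi$, $V|_\Sigma\ne0$. The type of $\pi$ at $p_0\in\Sigma$ is the smallest integer $k$ such that $V^k\det d\pi|_{p_0}\ne0$; the type of $\pi$ at $p\notin\Sigma$ is $0$. A map is of type at most $k$ if its type at every point is at most $k$. It is part of the type assumption that $h$ vanishes simply on $\{h=0\}$. *)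

theory Defs
  imports "HOL-Analysis.Analysis" "HOL-Probability.Essential_Supremum"
begin

section \<open>Smooth functions\<close>

text \<open>
  On an open set \<open>U\<close> the predicate \<open>Ck_on k U f\<close> says that \<open>f\<close> has continuous iterated directional
  derivatives up to order \<open>k\<close> on \<open>U\<close>, i.e. \<open>f\<close> is of class \<open>C\<^sup>k\<close> there.  It is only used for open \<open>U\<close>.
\<close>

primrec Ck_on :: "nat \<Rightarrow> 'a::euclidean_space set \<Rightarrow> ('a \<Rightarrow> 'b::real_normed_vector) \<Rightarrow> bool" where
  "Ck_on 0 U f \<longleftrightarrow> continuous_on U f"
| "Ck_on (Suc k) U f \<longleftrightarrow>
     (\<forall>x\<in>U. f differentiable (at x)) \<and>
     (\<forall>v. Ck_on k U (\<lambda>x. frechet_derivative f (at x) v))"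

definition smooth_on :: "'a::euclidean_space set \<Rightarrow> ('a \<Rightarrow> 'b::real_normed_vector) \<Rightarrow> bool" where
  "smooth_on U f \<longleftrightarrow> (\<forall>k. Ck_on k U f)"

definition supp :: "('a::topological_space \<Rightarrow> 'b::zero) \<Rightarrow> 'a set" where
  "supp f = closure {x. f x \<noteq> 0}"

section \<open>The phase function\<close>

text \<open>A point of \<open>\<real>\<^sup>n \<times> \<real>\<^sup>n\<close> is a pair \<open>(x, \<theta>)\<close>.\<close>

definition grad_x :: "((real^'n) \<times> (real^'n) \<Rightarrow> real) \<Rightarrow> (real^'n) \<times> (real^'n) \<Rightarrow> real^'n" where
  "grad_x S p = (\<chi> i. frechet_derivative S (at p) (axis i 1, 0))"

definition grad_theta :: "((real^'n) \<times> (real^'n) \<Rightarrow> real) \<Rightarrow> (real^'n) \<times> (real^'n) \<Rightarrow> real^'n" where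
  "grad_theta S p = (\<chi> j. frechet_derivative S (at p) (0, axis j 1))"

definition mixed_hessian :: "((real^'n) \<times> (real^'n) \<Rightarrow> real) \<Rightarrow> (real^'n) \<times> (real^'n) \<Rightarrow> real^'n^'n" where
  "mixed_hessian S p = (\<chi> i j. frechet_derivative (\<lambda>q. grad_x S q $ i) (at p) (0, axis j 1))"

definition proj_L :: "((real^'n) \<times> (real^'n) \<Rightarrow> real) \<Rightarrow> (real^'n) \<times> (real^'n) \<Rightarrow> (real^'n) \<times> (real^'n)" where
  "proj_L S p = (fst p, grad_x S p)"

definition proj_R :: "((real^'n) \<times> (real^'n) \<Rightarrow> real) \<Rightarrow> (real^'n) \<times> (real^'n) \<Rightarrow> (real^'n) \<times> (real^'n)" where
  "proj_R S p = (snd p, grad_theta S p)"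

section \<open>Type of a map\<close>

definition coord_vec :: "'n + 'n \<Rightarrow> (real^'n) \<times> (real^'n)" where
  "coord_vec a = (case a of Inl i \<Rightarrow> (axis i 1, 0) | Inr j \<Rightarrow> (0, axis j 1))"

definition jac_det :: "((real^'n) \<times> (real^'n) \<Rightarrow> (real^'n) \<times> (real^'n)) \<Rightarrow> (real^'n) \<times> (real^'n) \<Rightarrow> real" where
  "jac_det \<pi> p =
     det ((\<chi> a b. frechet_derivative \<pi> (at p) (coord_vec b) \<bullet> coord_vec a) :: real^('n+'n)^('n+'n))"

definition crit_set :: "((real^'n) \<times> (real^'n) \<Rightarrow> (real^'n) \<times> (real^'n)) \<Rightarrow> ((real^'n) \<times> (real^'n)) set" where
  "crit_set \<pi> = {p. jac_det \<pi> p = 0}"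

definition corank_le_1 :: "((real^'n) \<times> (real^'n) \<Rightarrow> (real^'n) \<times> (real^'n)) \<Rightarrow> bool" where
  "corank_le_1 \<pi> \<longleftrightarrow>
     (\<forall>p. dim (range (frechet_derivative \<pi> (at p))) + 1 \<ge> DIM((real^'n) \<times> (real^'n)))"

definition vanishes_simply :: "('a::euclidean_space \<Rightarrow> real) \<Rightarrow> bool" where
  "vanishes_simply f \<longleftrightarrow> (\<forall>p. f p = 0 \<longrightarrow> frechet_derivative f (at p) \<noteq> (\<lambda>v. 0))"

definition lie_deriv :: "('a::euclidean_space \<Rightarrow> 'a) \<Rightarrow> ('a \<Rightarrow> real) \<Rightarrow> 'a \<Rightarrow> real" where
  "lie_deriv V f = (\<lambda>p. frechet_derivative f (at p) (V p))"

text \<open>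
  A vector field on \<open>U\<close> generating the kernel of \<open>d\<pi>\<close> at the critical points in \<open>U\<close> (for maps of
  corank at most 1 that kernel is a line, so a nonzero element generates it).
\<close>

definition kernel_field ::
    "((real^'n) \<times> (real^'n) \<Rightarrow> (real^'n) \<times> (real^'n)) \<Rightarrow> ((real^'n) \<times> (real^'n)) set
     \<Rightarrow> ((real^'n) \<times> (real^'n) \<Rightarrow> (real^'n) \<times> (real^'n)) \<Rightarrow> bool" where
  "kernel_field \<pi> U V \<longleftrightarrow>
     open U \<and> smooth_on U V \<and>
     (\<forall>p \<in> U \<inter> crit_set \<pi>. frechet_derivative \<pi> (at p) (V p) = 0 \<and> V p \<noteq> 0)"

text \<open>
  For smooth maps of corank at most 1 kernel fields exist near every critical point; when moreover
  the Jacobian determinant vanishes simply, the number \<open>k\<close> below does not depend on the field, so it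
  may be computed with any of them.  A critical point that has no type in the sense below is one of
  infinite type.
\<close>

definition has_type_at ::
    "((real^'n) \<times> (real^'n) \<Rightarrow> (real^'n) \<times> (real^'n)) \<Rightarrow> (real^'n) \<times> (real^'n) \<Rightarrow> nat \<Rightarrow> bool" where
  "has_type_at \<pi> p k \<longleftrightarrow>
     (if p \<in> crit_set \<pi>
      then \<forall>U V. kernel_field \<pi> U V \<and> p \<in> U \<longrightarrow>
             (lie_deriv V ^^ k) (jac_det \<pi>) p \<noteq> 0 \<and>
             (\<forall>j<k. (lie_deriv V ^^ j) (jac_det \<pi>) p = 0)
      else k = 0)"

definition map_type_le :: "((real^'n) \<times> (real^'n) \<Rightarrow> (real^'n) \<times> (real^'n)) \<Rightarrow> nat \<Rightarrow> bool" where
  "map_type_le \<pi> m \<longleftrightarrow>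
     smooth_on UNIV \<pi> \<and> corank_le_1 \<pi> \<and> vanishes_simply (jac_det \<pi>) \<and>
     (\<forall>p. \<exists>k\<le>m. has_type_at \<pi> p k)"

section \<open>Operators and their norms\<close>

text \<open>
  The oscillatory integral operator with cutoff \<open>\<beta>(t\<^sup>-\<^sup>1 det S\<^sub>x\<^sub>\<theta>)\<close>, for real \<open>t \<noteq> 0\<close>.
\<close>

definition osc_op ::
    "((real^'n) \<times> (real^'n) \<Rightarrow> real) \<Rightarrow> ((real^'n) \<times> (real^'n) \<Rightarrow> complex) \<Rightarrow> (real \<Rightarrow> complex)
     \<Rightarrow> real \<Rightarrow> real \<Rightarrow> (real^'n \<Rightarrow> complex) \<Rightarrow> real^'n \<Rightarrow> complex" where
  "osc_op S \<psi> \<beta> lam t u x =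
     (\<integral>\<theta>. exp (\<i> * complex_of_real (lam * S (x, \<theta>))) * \<psi> (x, \<theta>)
           * \<beta> (inverse t * det (mixed_hessian S (x, \<theta>))) * u \<theta> \<partial>lborel)"

text \<open>Elements of \<open>L\<^sup>1\<close> and \<open>L\<^sup>\<infinity>\<close> are represented by Borel functions of finite norm.\<close>

definition L1_norm :: "('a::euclidean_space \<Rightarrow> complex) \<Rightarrow> ennreal" where
  "L1_norm u = (\<integral>\<^sup>+ x. ennreal (norm (u x)) \<partial>lborel)"

definition Linf_norm :: "('a::euclidean_space \<Rightarrow> complex) \<Rightarrow> ennreal" where
  "Linf_norm u = esssup lborel (\<lambda>x. ennreal (norm (u x)))"

text \<open>
  Operator norm on the space of (classes of) Borel functions with finite norm \<open>N\<close>.  It is infinite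
  if the operator does not map that space to measurable functions.
\<close>

definition op_norm ::
    "(('a::euclidean_space \<Rightarrow> complex) \<Rightarrow> ennreal) \<Rightarrow> (('a \<Rightarrow> complex) \<Rightarrow> ('a \<Rightarrow> complex)) \<Rightarrow> ennreal" where
  "op_norm N A =
     Inf {K. \<forall>u \<in> borel_measurable lborel. N u < \<infinity> \<longrightarrow>
               A u \<in> borel_measurable lborel \<and> N (A u) \<le> K * N u}"

end

theory Submission
  imports Defs
begin

text \<open>
  Both estimates are Schur tests: with \<open>h = det S\<^sub>x\<^sub>\<theta>\<close>, the kernel is bounded and supported where
  \<open>|h| \<le> 2\<epsilon>\<close>, so it suffices to bound by \<open>C \<epsilon>\<^bsup>1/l\<^esup>\<close> the measure of the sublevel sets of
  \<open>h(x, \<cdot>)\<close> on \<open>supp \<psi>\<close>, uniformly in \<open>x\<close>, and similarly in the other variable.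

  Up to sign \<open>h\<close> is the Jacobian determinant of \<open>\<pi>\<^sub>L\<close>, and rows of cofactors of \<open>S\<^sub>x\<^sub>\<theta>\<close> give a kernel
  field \<open>V\<close> that differentiates in \<open>\<theta>\<close> only.  If \<open>V\<^sup>k h \<noteq> 0\<close> at a point, then some iterated
  \<open>\<theta>\<close>-derivative of \<open>h\<close> of order at most \<open>k\<close> is nonzero there, hence, by polarization, some pure
  derivative \<open>(w \<cdot> \<partial>\<^sub>\<theta>)\<^sup>j h\<close> with \<open>j \<le> k\<close>.  So no straightening of \<open>V\<close> is needed: near the point, the
  one-dimensional sublevel estimate applies along all lines of direction \<open>w\<close>, and integrating over
  these lines gives the measure bound.
\<close>

section \<open>Smooth functions and iterated directional derivatives\<close>

definition dd :: "'a::euclidean_space \<Rightarrow> ('a \<Rightarrow> 'b::real_normed_vector) \<Rightarrow> 'a \<Rightarrow> 'b" where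
  "dd v f = (\<lambda>p. frechet_derivative f (at p) v)"

lemma dd_has_derivative:
  "(f has_derivative f') (at p) \<Longrightarrow> dd v f p = f' v"
  by (simp add: dd_def frechet_derivative_at[symmetric])

lemma Ck_on_Suc_UNIV:
  "Ck_on (Suc k) UNIV f \<longleftrightarrow> (\<forall>x. f differentiable (at x)) \<and> (\<forall>v. Ck_on k UNIV (dd v f))"
  by (simp add: dd_def)

declare Ck_on.simps(2) [simp del]

lemma differentiable_imp_Ck_on_0: "(\<And>x. f differentiable (at x)) \<Longrightarrow> Ck_on 0 UNIV f"
  by (simp add: continuous_at_imp_continuous_on differentiable_imp_continuous_within)

lemma Ck_on_Suc_imp: "Ck_on (Suc k) UNIV f \<Longrightarrow> Ck_on k UNIV f"
proof (induction k arbitrary: f)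
  case 0
  then show ?case by (intro differentiable_imp_Ck_on_0) (simp add: Ck_on_Suc_UNIV)
next
  case (Suc k)
  then show ?case by (subst Ck_on_Suc_UNIV) (subst (asm) (2) Ck_on_Suc_UNIV, blast)
qed

lemma smooth_on_subset: "smooth_on UNIV f \<Longrightarrow> smooth_on U f"
proof -
  have "Ck_on k UNIV f \<Longrightarrow> Ck_on k U f" for k
  proof (induction k arbitrary: f)
    case 0
    then show ?case by (auto intro: continuous_on_subset)
  next
    case (Suc k)
    then show ?case by (auto simp: Ck_on.simps(2))
  qed
  then show "smooth_on UNIV f \<Longrightarrow> smooth_on U f" by (simp add: smooth_on_def)
qed

text \<open>Smoothness survives one differentiation without loss of order, so later arguments need
  not count derivatives.\<close>

lemma smooth_on_UNIV_iff:
  "smooth_on UNIV f \<longleftrightarrow> (\<forall>x. f differentiable (at x)) \<and> (\<forall>v. smooth_on UNIV (dd v f))"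
  unfolding smooth_on_def
  by (metis Ck_on_Suc_UNIV Ck_on_Suc_imp)

lemma smooth_differentiable: "smooth_on UNIV f \<Longrightarrow> f differentiable (at x)"
  using smooth_on_UNIV_iff by blast

lemma smooth_dd: "smooth_on UNIV f \<Longrightarrow> smooth_on UNIV (dd v f)"
  using smooth_on_UNIV_iff by blast

lemma smooth_dd_pow: "smooth_on UNIV f \<Longrightarrow> smooth_on UNIV ((dd v ^^ k) f)"
  by (induction k) (auto intro: smooth_dd)

lemma smooth_continuous: "smooth_on UNIV f \<Longrightarrow> continuous_on UNIV f"
  by (auto simp: smooth_on_def dest: spec[of _ 0])

lemma smooth_has_derivative:
  "smooth_on UNIV f \<Longrightarrow> (f has_derivative (\<lambda>v. dd v f p)) (at p)"
  unfolding dd_def using frechet_derivative_works smooth_differentiable by fastforce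

lemma dd_linear: "smooth_on UNIV f \<Longrightarrow> linear (\<lambda>v. dd v f p)"
  using smooth_has_derivative has_derivative_linear by blast

lemma dd_add_dir: "smooth_on UNIV f \<Longrightarrow> dd (v + w) f = (\<lambda>p. dd v f p + dd w f p)"
  using linear_add[OF dd_linear[of f]] by (simp add: fun_eq_iff)

lemma dd_scale_dir: "smooth_on UNIV f \<Longrightarrow> dd (c *\<^sub>R v) f = (\<lambda>p. c *\<^sub>R dd v f p)"
  using linear_scale[OF dd_linear[of f]] by (simp add: fun_eq_iff)

lemma dd_const [simp]: "dd v (\<lambda>p. c) = (\<lambda>p. 0)"
  by (simp add: dd_def)

lemma smooth_const [intro!]: "smooth_on UNIV (\<lambda>p::'a::euclidean_space. c::'b::real_normed_vector)"
proof -
  \<comment> \<open>The constant is kept arbitrary in the induction because differentiation replaces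
    it by 0.\<close>
  have "Ck_on k UNIV (\<lambda>p::'a. c)" for k and c :: 'b
    by (induction k arbitrary: c) (auto simp: Ck_on_Suc_UNIV)
  then show ?thesis by (simp add: smooth_on_def)
qed

lemma dd_add:
  assumes "f differentiable (at p)" "g differentiable (at p)"
  shows "dd v (\<lambda>q. f q + g q) p = dd v f p + dd v g p"
  using dd_has_derivative[OF has_derivative_add[OF assms[unfolded frechet_derivative_works]]]
  by (simp add: dd_def)

lemma Ck_on_add: "Ck_on k UNIV f \<Longrightarrow> Ck_on k UNIV g \<Longrightarrow> Ck_on k UNIV (\<lambda>p. f p + g p)"
proof (induction k arbitrary: f g)
  case 0
  then show ?case by (auto intro: continuous_intros)
next
  case (Suc k)
  then have "dd v (\<lambda>p. f p + g p) = (\<lambda>p. dd v f p + dd v g p)" for v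
    using dd_add[of f _ g] by (auto simp: Ck_on_Suc_UNIV)
  then show ?case using Suc by (auto simp: Ck_on_Suc_UNIV)
qed

lemma smooth_add: "smooth_on UNIV f \<Longrightarrow> smooth_on UNIV g \<Longrightarrow> smooth_on UNIV (\<lambda>p. f p + g p)"
  by (simp add: smooth_on_def Ck_on_add)

lemma dd_scaleR:
  assumes "f differentiable (at p)" "g differentiable (at p)"
  shows "dd v (\<lambda>q. f q *\<^sub>R g q) p = f p *\<^sub>R dd v g p + dd v f p *\<^sub>R g p"
  using dd_has_derivative[OF has_derivative_scaleR[OF assms[unfolded frechet_derivative_works]]]
  by (simp add: dd_def)

lemma Ck_on_scaleR:
  "Ck_on k UNIV f \<Longrightarrow> Ck_on k UNIV g \<Longrightarrow> Ck_on k UNIV (\<lambda>p. f p *\<^sub>R g p)"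
proof (induction k arbitrary: f g)
  case 0
  then show ?case by (auto intro: continuous_intros)
next
  case (Suc k)
  then have "dd v (\<lambda>p. f p *\<^sub>R g p) = (\<lambda>p. f p *\<^sub>R dd v g p + dd v f p *\<^sub>R g p)" for v
    using dd_scaleR[of f _ g] by (auto simp: Ck_on_Suc_UNIV)
  moreover have "(\<lambda>p. f p *\<^sub>R g p) differentiable (at x)" for x
    using Suc.prems by (auto intro!: derivative_intros simp: Ck_on_Suc_UNIV)
  \<comment> \<open>The Leibniz rule leaves one factor undifferentiated, so \<open>f\<close> and
    \<open>g\<close> are also needed at the lower order \<open>k\<close>.\<close>
  moreover have "Ck_on k UNIV f" "Ck_on k UNIV g"
    using Suc.prems Ck_on_Suc_imp by blast+
  ultimately show ?case using Suc by (auto simp: Ck_on_Suc_UNIV intro: Ck_on_add)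
qed

lemma smooth_scaleR:
  "smooth_on UNIV f \<Longrightarrow> smooth_on UNIV g \<Longrightarrow> smooth_on UNIV (\<lambda>p. f p *\<^sub>R g p)"
  by (simp add: smooth_on_def Ck_on_scaleR)

lemma smooth_mult:
  fixes f g :: "'a::euclidean_space \<Rightarrow> real"
  shows "smooth_on UNIV f \<Longrightarrow> smooth_on UNIV g \<Longrightarrow> smooth_on UNIV (\<lambda>p. f p * g p)"
  using smooth_scaleR[of f g] by simp

lemma smooth_sum:
  "(\<And>i. i \<in> I \<Longrightarrow> smooth_on UNIV (f i)) \<Longrightarrow> smooth_on UNIV (\<lambda>p. \<Sum>i\<in>I. f i p)"
  by (induction I rule: infinite_finite_induct) (auto intro: smooth_add)

lemma smooth_prod:
  fixes f :: "'i \<Rightarrow> 'a::euclidean_space \<Rightarrow> real"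
  shows "(\<And>i. i \<in> I \<Longrightarrow> smooth_on UNIV (f i)) \<Longrightarrow> smooth_on UNIV (\<lambda>p. \<Prod>i\<in>I. f i p)"
  by (induction I rule: infinite_finite_induct) (auto intro: smooth_mult)

lemma smooth_det:
  fixes A :: "'a::euclidean_space \<Rightarrow> real^'n^'n"
  assumes "\<And>i j. smooth_on UNIV (\<lambda>p. A p $ i $ j)"
  shows "smooth_on UNIV (\<lambda>p. det (A p))"
  unfolding det_def using assms by (intro smooth_sum smooth_mult smooth_prod smooth_const) auto

text \<open>Restriction to a line turns directional derivatives into ordinary ones, which gives
  access to the one-variable mean value theorem.\<close>

lemma has_real_derivative_along_line:
  fixes f :: "'a::euclidean_space \<Rightarrow> real"
  assumes "smooth_on UNIV f"
  shows "((\<lambda>s. f (p + s *\<^sub>R v)) has_real_derivative dd v f (p + s *\<^sub>R v)) (at s within X)"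
proof -
  have "((\<lambda>s. p + s *\<^sub>R v) has_derivative (\<lambda>s. s *\<^sub>R v)) (at s within X)"
    by (auto intro!: derivative_eq_intros)
  from has_derivative_compose[OF this smooth_has_derivative[OF assms]]
  show ?thesis
    unfolding has_field_derivative_def
    by (rule has_derivative_eq_rhs) (simp add: dd_scale_dir[OF assms] fun_eq_iff)
qed

text \<open>Schwarz's theorem: both iterated derivatives are limits of the same second-order difference
  quotient, by two applications of the mean value theorem.\<close>

lemma second_difference_mvt:
  fixes f :: "'a::euclidean_space \<Rightarrow> real"
  assumes f: "smooth_on UNIV f" and t: "0 < t"
  shows "\<exists>a\<in>{0..t}. \<exists>b\<in>{0..t}.
    f (p + t *\<^sub>R v + t *\<^sub>R w) - f (p + t *\<^sub>R v) - f (p + t *\<^sub>R w) + f p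
      = t\<^sup>2 * dd w (dd v f) (p + a *\<^sub>R v + b *\<^sub>R w)"
proof -
  let ?g = "\<lambda>s. f (p + t *\<^sub>R w + s *\<^sub>R v) - f (p + s *\<^sub>R v)"
  have "(?g has_real_derivative dd v f (p + t *\<^sub>R w + s *\<^sub>R v) - dd v f (p + s *\<^sub>R v)) (at s)" for s
    by (intro DERIV_diff has_real_derivative_along_line f)
  from MVT2[OF t this] obtain a where a: "0 < a" "a < t"
    and 1: "?g t - ?g 0 = t * (dd v f (p + t *\<^sub>R w + a *\<^sub>R v) - dd v f (p + a *\<^sub>R v))" by auto
  have "((\<lambda>s. dd v f (p + a *\<^sub>R v + s *\<^sub>R w)) has_real_derivative
      dd w (dd v f) (p + a *\<^sub>R v + s *\<^sub>R w)) (at s)" for s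
    by (intro has_real_derivative_along_line smooth_dd f)
  from MVT2[OF t this] obtain b where b: "0 < b" "b < t"
    and 2: "dd v f (p + a *\<^sub>R v + t *\<^sub>R w) - dd v f (p + a *\<^sub>R v)
      = t * dd w (dd v f) (p + a *\<^sub>R v + b *\<^sub>R w)" by auto
  have "?g t - ?g 0 = t\<^sup>2 * dd w (dd v f) (p + a *\<^sub>R v + b *\<^sub>R w)"
    using 1 2 by (simp add: power2_eq_square algebra_simps)
  then show ?thesis using a b by (intro bexI[of _ a] bexI[of _ b]) (auto simp: algebra_simps)
qed

lemma dd_commute:
  fixes f :: "'a::euclidean_space \<Rightarrow> real"
  assumes f: "smooth_on UNIV f"
  shows "dd v (dd w f) = dd w (dd v f)"
proof
  fix p
  define t :: "nat \<Rightarrow> real" where "t n = inverse (real (Suc n))" for n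
  have t0: "t n > 0" for n by (simp add: t_def)
  have tl: "t \<longlonglongrightarrow> 0" unfolding t_def by (rule LIMSEQ_inverse_real_of_nat)
  define D where "D v w n = (f (p + t n *\<^sub>R v + t n *\<^sub>R w) - f (p + t n *\<^sub>R v) - f (p + t n *\<^sub>R w) + f p)
      / (t n)\<^sup>2" for v w n
  have lim: "D v w \<longlonglongrightarrow> dd w (dd v f) p" for v w
  proof -
    have "\<exists>a b. a\<in>{0..t n} \<and> b\<in>{0..t n} \<and> D v w n = dd w (dd v f) (p + a *\<^sub>R v + b *\<^sub>R w)" for n
    proof -
      from second_difference_mvt[OF f t0[of n], of p v w] obtain a b
        where "a \<in> {0..t n}" "b \<in> {0..t n}"
          "f (p + t n *\<^sub>R v + t n *\<^sub>R w) - f (p + t n *\<^sub>R v) - f (p + t n *\<^sub>R w) + f p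
            = (t n)\<^sup>2 * dd w (dd v f) (p + a *\<^sub>R v + b *\<^sub>R w)" by blast
      moreover have "(t n)\<^sup>2 \<noteq> 0" using t0[of n] by simp
      ultimately show ?thesis unfolding D_def by (intro exI[of _ a] exI[of _ b]) simp
    qed
    then obtain a b where ab: "\<And>n. a n \<in> {0..t n}" "\<And>n. b n \<in> {0..t n}"
        "\<And>n. D v w n = dd w (dd v f) (p + a n *\<^sub>R v + b n *\<^sub>R w)" by metis
    have al: "a \<longlonglongrightarrow> 0" and bl: "b \<longlonglongrightarrow> 0"
      using ab(1,2) by (auto intro!: tendsto_sandwich[OF _ _ tendsto_const tl])
    have "(\<lambda>n. p + a n *\<^sub>R v + b n *\<^sub>R w) \<longlonglongrightarrow> p + 0 *\<^sub>R v + 0 *\<^sub>R w"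
      by (intro tendsto_intros al bl)
    moreover have "isCont (dd w (dd v f)) p"
      using smooth_continuous[OF smooth_dd[OF smooth_dd[OF f]]]
      by (simp add: continuous_on_eq_continuous_at)
    ultimately have "(\<lambda>n. dd w (dd v f) (p + a n *\<^sub>R v + b n *\<^sub>R w)) \<longlonglongrightarrow> dd w (dd v f) p"
      using isCont_tendsto_compose by fastforce
    moreover have "D v w = (\<lambda>n. dd w (dd v f) (p + a n *\<^sub>R v + b n *\<^sub>R w))"
      using ab(3) by blast
    ultimately show ?thesis by metis
  qed
  have "D v w = D w v" by (simp add: D_def fun_eq_iff algebra_simps)
  then show "dd v (dd w f) p = dd w (dd v f) p"
    using lim[of v w] lim[of w v] LIMSEQ_unique by metis
qed

section \<open>From the type to a pure directional derivative\<close>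

primrec vanishes_order :: "'a::euclidean_space set \<Rightarrow> nat \<Rightarrow> ('a \<Rightarrow> real) \<Rightarrow> 'a \<Rightarrow> bool" where
  "vanishes_order D 0 f p \<longleftrightarrow> f p = 0"
| "vanishes_order D (Suc m) f p \<longleftrightarrow> f p = 0 \<and> (\<forall>w\<in>D. vanishes_order D m (dd w f) p)"

lemma vanishes_order_Suc_imp: "vanishes_order D (Suc m) f p \<Longrightarrow> vanishes_order D m f p"
  by (induction m arbitrary: f) auto

lemma vanishes_order_const_0: "vanishes_order D m (\<lambda>p. 0) p"
  by (induction m) auto

lemma dd_add_smooth:
  "smooth_on UNIV f \<Longrightarrow> smooth_on UNIV g \<Longrightarrow> dd w (\<lambda>p. f p + g p) = (\<lambda>p. dd w f p + dd w g p)"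
  by (intro ext dd_add smooth_differentiable)

lemma dd_mult_smooth:
  fixes f g :: "'a::euclidean_space \<Rightarrow> real"
  assumes "smooth_on UNIV f" "smooth_on UNIV g"
  shows "dd w (\<lambda>p. f p * g p) = (\<lambda>p. f p * dd w g p + dd w f p * g p)"
  using dd_scaleR[OF smooth_differentiable smooth_differentiable, OF assms] by auto

lemma vanishes_order_add:
  "smooth_on UNIV f \<Longrightarrow> smooth_on UNIV g \<Longrightarrow> vanishes_order D m f p \<Longrightarrow> vanishes_order D m g p
    \<Longrightarrow> vanishes_order D m (\<lambda>p. f p + g p) p"
  by (induction m arbitrary: f g) (auto simp: dd_add_smooth smooth_dd)

text \<open>A first derivative of \<open>a * f\<close> is \<open>a\<close> times a derivative of
  \<open>f\<close> plus a derivative of \<open>a\<close> times \<open>f\<close>. If \<open>f\<close>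
  vanishes to order \<open>m + 1\<close>, both terms have a factor vanishing to order
  \<open>m\<close>, so induction applies to each.\<close>

lemma vanishes_order_mult:
  "smooth_on UNIV a \<Longrightarrow> smooth_on UNIV f \<Longrightarrow> vanishes_order D m f p
    \<Longrightarrow> vanishes_order D m (\<lambda>p. a p * f p) p"
proof (induction m arbitrary: a f)
  case (Suc m)
  have "vanishes_order D m (dd w (\<lambda>p. a p * f p)) p" if "w \<in> D" for w
    unfolding dd_mult_smooth[OF Suc.prems(1,2)]
    using Suc.prems vanishes_order_Suc_imp[OF Suc.prems(3)] that
    by (intro vanishes_order_add Suc.IH smooth_mult smooth_dd) auto
  then show ?case using Suc.prems by auto
qed auto

lemma vanishes_order_sum:
  "finite I \<Longrightarrow> (\<And>i. i \<in> I \<Longrightarrow> smooth_on UNIV (f i)) \<Longrightarrow> (\<And>i. i \<in> I \<Longrightarrow> vanishes_order D m (f i) p)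
    \<Longrightarrow> vanishes_order D m (\<lambda>p. \<Sum>i\<in>I. f i p) p"
  by (induction I rule: finite_induct)
    (auto intro!: vanishes_order_add smooth_sum simp: vanishes_order_const_0)

text \<open>Writing the field in finitely many fixed directions turns the Lie derivative into
  constant-direction derivatives with variable coefficients.\<close>

lemma lie_deriv_sum:
  assumes "smooth_on UNIV f"
  shows "lie_deriv (\<lambda>p. \<Sum>i\<in>I. a i p *\<^sub>R d i) f = (\<lambda>p. \<Sum>i\<in>I. a i p * dd (d i) f p)"
proof
  fix p
  have "lie_deriv (\<lambda>p. \<Sum>i\<in>I. a i p *\<^sub>R d i) f p = dd (\<Sum>i\<in>I. a i p *\<^sub>R d i) f p"
    by (simp add: lie_deriv_def dd_def)
  also have "\<dots> = (\<Sum>i\<in>I. a i p * dd (d i) f p)"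
    by (simp add: linear_sum[OF dd_linear[OF assms]] linear_scale[OF dd_linear[OF assms]])
  finally show "lie_deriv (\<lambda>p. \<Sum>i\<in>I. a i p *\<^sub>R d i) f p = (\<Sum>i\<in>I. a i p * dd (d i) f p)" .
qed

text \<open>Each Lie derivative is a smooth combination of first derivatives in directions from
  \<open>D\<close>, so it lowers the order of vanishing by at most one. Read contrapositively, a
  nonzero \<open>k\<close>-fold Lie derivative yields a nonzero mixed derivative of order at most
  \<open>k\<close>.\<close>

lemma lie_deriv_pow_eq_0:
  assumes I: "finite I" and a: "\<And>i. i \<in> I \<Longrightarrow> smooth_on UNIV (a i)" and d: "\<And>i. i \<in> I \<Longrightarrow> d i \<in> D"
  shows "smooth_on UNIV f \<Longrightarrow> vanishes_order D k f p
    \<Longrightarrow> (lie_deriv (\<lambda>p. \<Sum>i\<in>I. a i p *\<^sub>R d i) ^^ k) f p = 0"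
proof (induction k arbitrary: f)
  case (Suc k)
  let ?L = "lie_deriv (\<lambda>p. \<Sum>i\<in>I. a i p *\<^sub>R d i)"
  have "vanishes_order D k (?L f) p"
    unfolding lie_deriv_sum[OF Suc.prems(1)] using I a d Suc.prems
    by (intro vanishes_order_sum vanishes_order_mult smooth_mult smooth_dd) auto
  moreover have "smooth_on UNIV (?L f)"
    unfolding lie_deriv_sum[OF Suc.prems(1)] using a Suc.prems
    by (intro smooth_sum smooth_mult smooth_dd)
  ultimately show ?case using Suc.IH by (simp add: funpow_swap1)
qed auto

lemma dd_pow_add:
  "smooth_on UNIV f \<Longrightarrow> smooth_on UNIV g
    \<Longrightarrow> (dd w ^^ k) (\<lambda>p. f p + g p) = (\<lambda>p. (dd w ^^ k) f p + (dd w ^^ k) g p)"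
  by (induction k) (auto simp: dd_add_smooth smooth_dd_pow)

lemma dd_pow_cmult:
  fixes f :: "'a::euclidean_space \<Rightarrow> real"
  shows "smooth_on UNIV f \<Longrightarrow> (dd w ^^ k) (\<lambda>p. c * f p) = (\<lambda>p. c * (dd w ^^ k) f p)"
  by (induction k) (auto simp: dd_mult_smooth smooth_dd_pow smooth_const)

text \<open>Polarization, infinitesimally: only the linear part in \<open>s\<close> of a pure power of \<open>w + s u\<close> is needed.\<close>

lemma dd_pow_direction_derivative:
  fixes f :: "'a::euclidean_space \<Rightarrow> real"
  assumes "smooth_on UNIV f"
  shows "((\<lambda>s. (dd (w + s *\<^sub>R u) ^^ k) f p) has_real_derivative
           real k * (dd w ^^ (k - 1)) (dd u f) p) (at 0)"
  using assms
proof (induction k arbitrary: f)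
  case (Suc k)
  note f = Suc.prems
  \<comment> \<open>Linearity in the direction is applied to the innermost derivative only; the
    induction hypothesis handles the \<open>k\<close> outer ones for \<open>dd w f\<close> and
    \<open>dd u f\<close> separately.\<close>
  have split: "(dd (w + s *\<^sub>R u) ^^ Suc k) f p
      = (dd (w + s *\<^sub>R u) ^^ k) (dd w f) p + s * (dd (w + s *\<^sub>R u) ^^ k) (dd u f) p" for s
  proof -
    have "dd (w + s *\<^sub>R u) f = (\<lambda>p. dd w f p + s * dd u f p)"
      using f by (simp add: dd_add_dir dd_scale_dir)
    then show ?thesis
      using f by (simp add: funpow_swap1 dd_pow_add dd_pow_cmult smooth_dd smooth_mult smooth_const)
  qed
  have D: "((\<lambda>s. (dd (w + s *\<^sub>R u) ^^ k) (dd w f) p + s * (dd (w + s *\<^sub>R u) ^^ k) (dd u f) p)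
      has_real_derivative real k * (dd w ^^ (k - 1)) (dd u (dd w f)) p
        + (1 * (dd (w + 0 *\<^sub>R u) ^^ k) (dd u f) p
           + real k * (dd w ^^ (k - 1)) (dd u (dd u f)) p * 0)) (at 0)"
    by (intro DERIV_add DERIV_mult DERIV_ident Suc.IH smooth_dd f)
  \<comment> \<open>For \<open>k = 0\<close> the truncated \<open>k - 1\<close> is harmless because
    of the factor \<open>real k\<close>. For \<open>k > 0\<close> Schwarz's theorem moves
    \<open>u\<close> to the innermost place.\<close>
  have eq: "real k * (dd w ^^ (k - 1)) (dd u (dd w f)) p = real k * (dd w ^^ k) (dd u f) p"
  proof (cases k)
    case (Suc m)
    have "dd u (dd w f) = dd w (dd u f)" by (rule dd_commute[OF f])
    then show ?thesis by (simp add: Suc funpow_swap1)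
  qed auto
  show ?case
    using D[unfolded eq] unfolding split by (simp add: algebra_simps)
qed auto

text \<open>Since \<open>D\<close> is a subspace, \<open>w + s u\<close> stays in it for every
  \<open>s\<close>, so the pure derivatives along it vanish identically in \<open>s\<close>. Their
  derivative at \<open>s = 0\<close> is a positive multiple of a pure derivative of
  \<open>dd u f\<close>, which therefore satisfies the hypothesis with one order less.\<close>

lemma vanishes_order_if_pure:
  fixes f :: "'a::euclidean_space \<Rightarrow> real"
  assumes "subspace D" "smooth_on UNIV f" "\<And>j w. j \<le> k \<Longrightarrow> w \<in> D \<Longrightarrow> (dd w ^^ j) f p = 0"
  shows "vanishes_order D k f p"
  using assms(2,3)
proof (induction k arbitrary: f)
  case 0
  then show ?case using 0(2)[OF le_refl subspace_0[OF assms(1)]] by simp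
next
  case (Suc k)
  have "vanishes_order D k (dd u f) p" if u: "u \<in> D" for u
  proof (rule Suc.IH)
    fix j w assume j: "j \<le> k" and w: "w \<in> D"
    have "(\<lambda>s. (dd (w + s *\<^sub>R u) ^^ Suc j) f p) = (\<lambda>s. 0)"
      using j w u assms(1) by (intro ext Suc.prems(2)) (auto intro: subspace_add subspace_scale)
    then have "real (Suc j) * (dd w ^^ j) (dd u f) p = 0"
      using dd_pow_direction_derivative[OF Suc.prems(1), where w = w and u = u and k = "Suc j" and p = p]
      by (metis DERIV_const DERIV_unique diff_Suc_1)
    then show "(dd w ^^ j) (dd u f) p = 0" by simp
  qed (use Suc.prems smooth_dd in auto)
  moreover have "f p = 0" using Suc.prems(2)[OF le0 subspace_0[OF assms(1)]] by simp
  ultimately show ?case by simp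
qed

section \<open>Cofactor rows and kernels of matrices\<close>

definition cofactor_row :: "'n \<Rightarrow> real^'n^'n \<Rightarrow> real^'n" where
  "cofactor_row i A = (\<chi> k. det (\<chi> a. if a = i then axis k 1 else A $ a))"

text \<open>This is Laplace expansion along row \<open>i\<close>: replacing that row by the
  \<open>k\<close>-th unit vector gives the cofactor at position \<open>(i, k)\<close>. Hence
  \<open>cofactor_row i A\<close> is a row of the cofactor matrix, that is, a column of the
  adjugate.\<close>

lemma det_replace_row:
  fixes A :: "real^'n^'n"
  shows "det (\<chi> a. if a = i then b else A $ a) = (\<Sum>k\<in>UNIV. b $ k * cofactor_row i A $ k)"
proof -
  have "det (\<chi> a. if a = i then b else A $ a) = det (\<chi> a. if a = i then (\<Sum>k\<in>UNIV. b $ k *s axis k 1) else A $ a)"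
    by (subst basis_expansion) simp
  also have "\<dots> = (\<Sum>k\<in>UNIV. b $ k * det (\<chi> a. if a = i then axis k 1 else A $ a))"
    by (simp add: det_linear_row_sum det_row_mul)
  finally show ?thesis by (simp add: cofactor_row_def)
qed

text \<open>Entry \<open>m\<close> is the determinant of \<open>A\<close> with row \<open>i\<close>
  replaced by row \<open>m\<close>; for \<open>m \<noteq> i\<close> two rows coincide. Where
  \<open>det A = 0\<close>, the cofactor row thus lies in the kernel and depends polynomially on
  \<open>A\<close>.\<close>

lemma matrix_mult_cofactor_row:
  fixes A :: "real^'n^'n"
  shows "A *v cofactor_row i A = axis i (det A)"
proof -
  have "(A *v cofactor_row i A) $ m = axis i (det A) $ m" for m
  proof -
    have *: "(A *v cofactor_row i A) $ m = det (\<chi> a. if a = i then A $ m else A $ a)"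
      by (simp add: det_replace_row matrix_vector_mult_def)
    show ?thesis
    proof (cases "m = i")
      case True
      then have "(\<chi> a. if a = i then A $ m else A $ a) = A" by (simp add: vec_eq_iff)
      then show ?thesis using * True by (simp add: axis_def)
    next
      case False
      then have "det (\<chi> a. if a = i then A $ m else A $ a) = 0"
        by (intro det_identical_rows[of i m]) (auto simp: row_def vec_eq_iff)
      then show ?thesis using * False by (simp add: axis_def)
    qed
  qed
  then show ?thesis by (simp add: vec_eq_iff)
qed

text \<open>If \<open>det A = 0\<close>, some row depends on the others, which then still span a
  space of dimension \<open>rank A\<close>. Replacing that row by a vector outside the span makes
  the rank full, and the resulting nonzero determinant is a combination of the cofactors of that
  row.\<close>

lemma cofactor_row_nonzero:
  fixes A :: "real^'n^'n"
  assumes "rank A \<ge> CARD('n) - 1"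
  shows "\<exists>i. cofactor_row i A \<noteq> 0"
proof (cases "det A = 0")
  case False
  have "axis i (det A) \<noteq> 0" for i :: 'n using False by simp
  then have "A *v cofactor_row i A \<noteq> 0" for i by (simp add: matrix_mult_cofactor_row)
  then show ?thesis by (metis matrix_vector_mult_0_right)
next
  case True
  have "rank (transpose A) < CARD('n)"
    using True by (simp add: det_eq_0_rank rank_transpose)
  \<comment> \<open>A nonzero entry of a left null vector marks a row that is a combination of the
    others.\<close>
  then obtain y where y: "y \<noteq> 0" "transpose A *v y = 0"
    using matrix_nonfull_linear_equations_eq[of "transpose A"] by auto
  then obtain i where i: "y $ i \<noteq> 0" by (auto simp: vec_eq_iff)
  let ?O = "(\<lambda>m. A $ m) ` (UNIV - {i})"
  have "(\<Sum>m\<in>UNIV. y $ m *\<^sub>R A $ m) = 0"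
    using y(2) by (simp add: vec_eq_iff matrix_vector_mult_def transpose_def mult.commute)
  then have "y $ i *\<^sub>R A $ i = - (\<Sum>m\<in>UNIV - {i}. y $ m *\<^sub>R A $ m)"
    by (simp add: sum.remove[of UNIV i] eq_neg_iff_add_eq_0)
  also have "\<dots> \<in> span ?O"
    by (intro span_neg span_sum span_scale span_base) auto
  finally have "(1 / y $ i) *\<^sub>R y $ i *\<^sub>R A $ i \<in> span ?O" by (rule span_scale)
  then have Ai: "A $ i \<in> span ?O" using i by simp
  have rows: "rows A = insert (A $ i) ?O" by (auto simp: rows_def row_def)
  have "dim (rows A) = dim ?O" using Ai rows dim_insert[of "A $ i" ?O] by simp
  then have dO: "dim ?O = rank A" by (simp add: row_rank_def)
  also have "\<dots> < CARD('n)" using True by (simp add: det_eq_0_rank)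
  finally have "span ?O \<noteq> UNIV"
    by (metis dim_UNIV dim_span DIM_cart DIM_real mult.right_neutral nat_less_le)
  then obtain b where b: "b \<notin> span ?O" by auto
  let ?A = "(\<chi> a. if a = i then b else A $ a) :: real^'n^'n"
  have "rows ?A = insert b ?O" by (auto simp: rows_def row_def)
  then have "rank ?A = rank A + 1"
    using b dO dim_insert[of b ?O] by (simp add: row_rank_def)
  then have "det ?A \<noteq> 0" using assms by (simp add: det_eq_0_rank)
  then show ?thesis unfolding det_replace_row by (intro exI[of _ i]) auto
qed

lemma smooth_cofactor_row:
  fixes M :: "'a::euclidean_space \<Rightarrow> real^'n^'n"
  assumes "\<And>i j. smooth_on UNIV (\<lambda>p. M p $ i $ j)"
  shows "smooth_on UNIV (\<lambda>p. cofactor_row i (M p) $ k)"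
proof -
  have "smooth_on UNIV (\<lambda>p. (if a = i then axis k 1 else M p $ a) $ b)" for a b
    using assms by (cases "a = i") auto
  then have "smooth_on UNIV (\<lambda>p. det (\<chi> a. if a = i then axis k 1 else M p $ a))"
    by (intro smooth_det) simp
  then show ?thesis by (simp add: cofactor_row_def)
qed

text \<open>Stated for a general \<open>M\<close> and \<open>\<iota>\<close> to serve both
  projections: the mixed Hessian with \<open>v\<close> sent to \<open>(0, v)\<close> for the left
  one, its transpose with \<open>v\<close> sent to \<open>(v, 0)\<close> for the right one. A
  cofactor row of \<open>M\<close>, carried over by \<open>\<iota>\<close>, is a kernel field; the
  type makes an iterated Lie derivative along it nonzero, and hence some pure derivative. Equality
  up to sign of the two determinants gives the same critical set.\<close>

lemma type_imp_pure_derivative: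
  fixes \<pi> :: "(real^'n) \<times> (real^'n) \<Rightarrow> (real^'n) \<times> (real^'n)" and \<iota> :: "real^'n \<Rightarrow> (real^'n) \<times> (real^'n)"
    and M :: "(real^'n) \<times> (real^'n) \<Rightarrow> real^'n^'n"
  assumes \<iota>: "linear \<iota>" "inj \<iota>"
    and M: "\<And>i j. smooth_on UNIV (\<lambda>p. M p $ i $ j)" "\<And>p. rank (M p) \<ge> CARD('n) - 1"
    and ker: "\<And>p v. M p *v v = 0 \<Longrightarrow> frechet_derivative \<pi> (at p) (\<iota> v) = 0"
    and J: "smooth_on UNIV (jac_det \<pi>)" "\<And>p. \<bar>jac_det \<pi> p\<bar> = \<bar>det (M p)\<bar>"
    and type: "map_type_le \<pi> m" and p: "jac_det \<pi> p = 0"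
  shows "\<exists>w. \<exists>j\<le>m. (dd (\<iota> w) ^^ j) (jac_det \<pi>) p \<noteq> 0"
proof -
  obtain i where i: "cofactor_row i (M p) \<noteq> 0" using cofactor_row_nonzero[OF M(2)] by blast
  define W where "W q = cofactor_row i (M q)" for q
  have Ws: "smooth_on UNIV (\<lambda>q. W q $ k)" for k
    unfolding W_def by (rule smooth_cofactor_row[OF M(1)])
  \<comment> \<open>The field is written as a sum over basis directions to fit
    \<open>lie_deriv_pow_eq_0\<close>; it equals \<open>\<iota> (W q)\<close>.\<close>
  define V where "V q = (\<Sum>k\<in>UNIV. W q $ k *\<^sub>R \<iota> (axis k 1))" for q
  have V: "V q = \<iota> (W q)" for q
  proof -
    have "\<iota> (W q) = \<iota> (\<Sum>k\<in>UNIV. W q $ k *\<^sub>R axis k 1)"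
      using basis_expansion[of "W q"] by (simp add: scalar_mult_eq_scaleR)
    then show ?thesis by (simp add: V_def linear_sum[OF \<iota>(1)] linear_scale[OF \<iota>(1)])
  qed
  have Vs: "smooth_on UNIV V"
    unfolding V_def[abs_def] by (intro smooth_sum smooth_scaleR Ws smooth_const)
  \<comment> \<open>The row index \<open>i\<close> was chosen at \<open>p\<close>, and the same row
    may vanish elsewhere, so the field is restricted to where it is nonzero.\<close>
  define U where "U = {q. V q \<noteq> 0}"
  have "open U"
    unfolding U_def by (intro open_Collect_neq smooth_continuous Vs continuous_on_const)
  have "kernel_field \<pi> U V"
    unfolding kernel_field_def
  proof (intro conjI ballI)
    fix q assume "q \<in> U \<inter> crit_set \<pi>"
    then have "det (M q) = 0" and "V q \<noteq> 0" using J(2)[of q] by (auto simp: crit_set_def U_def)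
    then have "M q *v W q = 0" by (simp add: W_def matrix_mult_cofactor_row)
    then show "frechet_derivative \<pi> (at q) (V q) = 0" "V q \<noteq> 0"
      using ker \<open>V q \<noteq> 0\<close> by (auto simp: V)
  qed (use \<open>open U\<close> Vs smooth_on_subset in auto)
  moreover have "p \<in> U"
    using i \<iota> unfolding U_def mem_Collect_eq V W_def by (metis inj_eq linear_0)
  moreover obtain k where k: "k \<le> m" "has_type_at \<pi> p k"
    using type unfolding map_type_le_def by blast
  ultimately have nz: "(lie_deriv V ^^ k) (jac_det \<pi>) p \<noteq> 0"
    using p by (auto simp: has_type_at_def crit_set_def)
  have "(lie_deriv V ^^ k) (jac_det \<pi>) p = 0" if "vanishes_order (range \<iota>) k (jac_det \<pi>) p"
    unfolding V_def[abs_def] using Ws J(1) that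
    by (intro lie_deriv_pow_eq_0[where D = "range \<iota>"]) auto
  then have "\<not> vanishes_order (range \<iota>) k (jac_det \<pi>) p" using nz by blast
  moreover have "subspace (range \<iota>)"
    using \<iota>(1) by (simp add: linear_subspace_image)
  ultimately have "\<exists>j w. j \<le> k \<and> (dd (\<iota> w) ^^ j) (jac_det \<pi>) p \<noteq> 0"
    using vanishes_order_if_pure[of "range \<iota>" "jac_det \<pi>" k p] J(1) by blast
  then show ?thesis using k(1) by (meson le_trans)
qed

section \<open>Jacobian determinants of the two projections\<close>

lemma map_sum_id_permutes:
  fixes q :: "'m::finite \<Rightarrow> 'm"
  assumes "q permutes UNIV"
  shows "map_sum id q permutes (UNIV :: ('k::finite + 'm) set) \<and> sign (map_sum id q :: 'k + 'm \<Rightarrow> _) = sign q"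
  using assms finite
proof (induction rule: permutes_induct)
  case id
  have "map_sum id id = (id :: 'k + 'm \<Rightarrow> _)" by (rule sum.map_id0)
  then show ?case by (simp only: permutes_id sign_id)
next
  case (swap a b p)
  have eq: "map_sum id (Transposition.transpose a b \<circ> p)
      = Transposition.transpose (Inr a) (Inr b) \<circ> (map_sum id p :: 'k + 'm \<Rightarrow> _)"
  proof
    fix x :: "'k + 'm"
    show "map_sum id (Transposition.transpose a b \<circ> p) x
      = (Transposition.transpose (Inr a) (Inr b) \<circ> (map_sum id p :: 'k + 'm \<Rightarrow> _)) x"
      by (cases x) (auto simp: Transposition.transpose_def)
  qed
  have perm: "permutation p" "permutation (map_sum id p :: 'k + 'm \<Rightarrow> _)"
    using swap finite permutation_permutes by blast+
  have "Transposition.transpose (Inr a) (Inr b) \<circ> (map_sum id p :: 'k + 'm \<Rightarrow> _) permutes UNIV"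
    by (intro permutes_compose[OF conjunct1[OF swap.IH]] permutes_swap_id UNIV_I)
  moreover have "sign (Transposition.transpose (Inr a) (Inr b) \<circ> (map_sum id p :: 'k + 'm \<Rightarrow> _))
      = sign (Transposition.transpose a b \<circ> p)"
    unfolding sign_compose[OF permutation_swap_id perm(1)] sign_compose[OF permutation_swap_id perm(2)]
      sign_swap_id conjunct2[OF swap.IH] by simp
  ultimately show ?case unfolding eq by blast
qed

text \<open>In the Leibniz expansion a nonzero term forces the permutation to fix every
  \<open>Inl i\<close>. By injectivity it then permutes the \<open>Inr\<close> part, and extending
  by the identity does not change the sign.\<close>

lemma det_block_lower_identity:
  fixes A :: "real^'m^'m" and B :: "'m \<Rightarrow> 'k::finite \<Rightarrow> real" and M :: "real^('k+'m)^('k+'m)"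
  assumes Mll: "\<And>i j. M $ Inl i $ Inl j = (if i = j then 1 else 0)"
    and Mlr: "\<And>i j. M $ Inl i $ Inr j = 0"
    and Mrr: "\<And>i j. M $ Inr i $ Inr j = A $ i $ j"
  shows "det M = det A"
proof -
  let ?P = "{p. p permutes (UNIV :: ('k+'m) set)}" and ?Q = "{q. q permutes (UNIV :: 'm set)}"
  let ?t = "\<lambda>p. of_int (sign p) * (\<Prod>i\<in>UNIV. M $ i $ p i)"
  let ?e = "\<lambda>q. map_sum id q :: 'k + 'm \<Rightarrow> 'k + 'm"
  have inj: "inj_on ?e ?Q"
  proof (rule inj_onI, rule ext)
    fix q q' :: "'m \<Rightarrow> 'm" and x assume "?e q = ?e q'"
    then have "?e q (Inr x) = ?e q' (Inr x)" by metis
    then show "q x = q' x" by simp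
  qed
  have zero: "?t p = 0" if p: "p \<in> ?P - ?e ` ?Q" for p
  proof (rule ccontr)
    assume nz: "?t p \<noteq> 0"
    then have nzi: "M $ i $ p i \<noteq> 0" for i by auto
    have pl: "p (Inl i) = Inl i" for i
      using nzi[of "Inl i"] by (cases "p (Inl i)") (auto simp: Mll Mlr split: if_splits)
    have inj: "inj p" using p permutes_inj by blast
    have "\<exists>j. p (Inr i) = Inr j" for i
    proof (cases "p (Inr i)")
      case (Inl j)
      then have "p (Inr i) = p (Inl j)" using pl by simp
      then show ?thesis using inj by (auto dest: injD)
    qed auto
    then obtain q where q: "\<And>i. p (Inr i) = Inr (q i)" by metis
    have "p = ?e q"
    proof
      fix x show "p x = ?e q x" by (cases x) (auto simp: pl q)
    qed
    moreover have "inj q"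
      using inj q by (metis injD injI sum.inject(2))
    then have "q permutes UNIV"
      by (intro bij_imp_permutes) (auto simp: finite_UNIV_inj_surj bij_def)
    ultimately show False using p by auto
  qed
  have "det M = sum ?t ?P" by (simp add: det_def)
  also have "\<dots> = sum ?t (?e ` ?Q)"
    using zero map_sum_id_permutes by (intro sum.mono_neutral_right) (auto simp: finite_permutations)
  also have "\<dots> = (\<Sum>q\<in>?Q. ?t (?e q))"
    by (simp add: sum.reindex[OF inj])
  also have "\<dots> = det A"
    unfolding det_def
  proof (rule sum.cong[OF refl])
    fix q assume "q \<in> ?Q"
    then have "sign (?e q) = sign q" using map_sum_id_permutes by auto
    moreover have "(\<Prod>i\<in>UNIV. M $ i $ ?e q i) = (\<Prod>i\<in>UNIV. A $ i $ q i)"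
    proof -
      have "(\<Prod>i\<in>UNIV. M $ i $ ?e q i)
          = (\<Prod>i\<in>range Inl. M $ i $ ?e q i) * (\<Prod>i\<in>range Inr. M $ i $ ?e q i)"
        unfolding UNIV_sum by (rule prod.union_disjoint) auto
      then show ?thesis by (simp add: prod.reindex Mll Mrr)
    qed
    ultimately show "?t (?e q) = of_int (sign q) * (\<Prod>i\<in>UNIV. A $ i $ q i)" by simp
  qed
  finally show ?thesis .
qed

lemma abs_det_permute_columns:
  fixes A :: "real^'k^'k"
  assumes "bij p"
  shows "\<bar>det (\<chi> i j. A $ i $ p j)\<bar> = \<bar>det A\<bar>"
proof -
  have "p permutes UNIV" using assms by (intro bij_imp_permutes) auto
  then show ?thesis by (simp add: det_permute_columns abs_mult flip: of_int_abs)
qed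

section \<open>Differentials of the two projections\<close>

lemma axis_nth: "axis i (1::real) $ j = (if i = j then 1 else 0)"
  by (simp add: axis_def)

context
  fixes S :: "(real^'n) \<times> (real^'n) \<Rightarrow> real"
  assumes S: "smooth_on UNIV S"
begin

lemma mixed_hessian_nth:
  "mixed_hessian S p $ i $ j = dd (0, axis j 1) (dd (axis i 1, 0) S) p"
  by (simp add: mixed_hessian_def grad_x_def dd_def)

lemma smooth_mixed_hessian: "smooth_on UNIV (\<lambda>p. mixed_hessian S p $ i $ j)"
  unfolding mixed_hessian_nth by (intro smooth_dd S)

lemma has_derivative_vec_dd:
  fixes d :: "'n \<Rightarrow> (real^'n) \<times> (real^'n)"
  shows "((\<lambda>q. \<chi> i. dd (d i) S q) has_derivative (\<lambda>v. \<chi> i. dd v (dd (d i) S) p)) (at p)"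
  using smooth_has_derivative[OF smooth_dd[OF S]]
  by (subst has_derivative_componentwise_within) (auto simp: Basis_vec_def inner_axis)

lemma frechet_proj_L:
  "frechet_derivative (proj_L S) (at p) v = (fst v, \<chi> i. dd v (dd (axis i 1, 0) S) p)"
proof -
  have "proj_L S = (\<lambda>q. (fst q, \<chi> i. dd (axis i 1, 0) S q))"
    by (simp add: fun_eq_iff proj_L_def grad_x_def dd_def)
  then have "(proj_L S has_derivative (\<lambda>v. (fst v, \<chi> i. dd v (dd (axis i 1, 0) S) p))) (at p)"
    by (auto intro!: derivative_eq_intros has_derivative_vec_dd)
  then show ?thesis by (simp add: frechet_derivative_at[symmetric])
qed

lemma frechet_proj_R:
  "frechet_derivative (proj_R S) (at p) v = (snd v, \<chi> i. dd v (dd (0, axis i 1) S) p)"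
proof -
  have "proj_R S = (\<lambda>q. (snd q, \<chi> i. dd (0, axis i 1) S q))"
    by (simp add: fun_eq_iff proj_R_def grad_theta_def dd_def)
  then have "(proj_R S has_derivative (\<lambda>v. (snd v, \<chi> i. dd v (dd (0, axis i 1) S) p))) (at p)"
    by (auto intro!: derivative_eq_intros has_derivative_vec_dd)
  then show ?thesis by (simp add: frechet_derivative_at[symmetric])
qed

text \<open>The differential has block rows \<open>(I, 0)\<close> and
  \<open>(S_xx, S_x\<theta>)\<close>.\<close>

lemma jac_det_proj_L: "jac_det (proj_L S) p = det (mixed_hessian S p)"
  unfolding jac_det_def
  by (rule det_block_lower_identity)
    (auto simp: frechet_proj_L coord_vec_def mixed_hessian_nth inner_axis axis_nth)

text \<open>The block rows are \<open>(0, I)\<close> and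
  \<open>(S_\<theta>x, S_\<theta>\<theta>)\<close>. Exchanging the two column blocks through
  \<open>\<sigma>\<close> gives the triangular form at the cost of a sign, and Schwarz's theorem
  identifies \<open>S_\<theta>x\<close> with the transposed mixed Hessian.\<close>

lemma abs_jac_det_proj_R: "\<bar>jac_det (proj_R S) p\<bar> = \<bar>det (mixed_hessian S p)\<bar>"
proof -
  define M where "M = ((\<chi> a b. frechet_derivative (proj_R S) (at p) (coord_vec b) \<bullet> coord_vec a)
    :: real^('n+'n)^('n+'n))"
  define \<sigma> where "\<sigma> = (\<lambda>a :: 'n + 'n. case a of Inl i \<Rightarrow> Inr i | Inr i \<Rightarrow> Inl i)"
  have "bij \<sigma>"
    by (rule o_bij[of \<sigma>]) (auto simp: fun_eq_iff \<sigma>_def split: sum.splits)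
  have "\<bar>jac_det (proj_R S) p\<bar> = \<bar>det (\<chi> i j. M $ i $ \<sigma> j)\<bar>"
    using abs_det_permute_columns[OF \<open>bij \<sigma>\<close>, of M] by (simp add: jac_det_def M_def)
  also have "det (\<chi> i j. M $ i $ \<sigma> j) = det (transpose (mixed_hessian S p))"
    by (rule det_block_lower_identity)
      (auto simp: M_def \<sigma>_def frechet_proj_R coord_vec_def mixed_hessian_nth inner_axis axis_nth
        transpose_def dd_commute[OF S])
  finally show ?thesis by simp
qed

text \<open>On \<open>(0, v)\<close> the differential of the left projection has first component 0
  and this vector as second component, so null vectors of the matrix give kernel directions.\<close>

lemma mixed_hessian_mult:
  "mixed_hessian S p *v v = (\<chi> i. dd (0, v) (dd (axis i 1, 0) S) p)"
proof -
  have "linear (\<lambda>v. dd (0, v) f p)" if "smooth_on UNIV f" for f :: "(real^'n) \<times> (real^'n) \<Rightarrow> real"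
    using linear_compose[OF _ dd_linear[OF that], of "\<lambda>v. (0, v)"] by (simp add: o_def linear_iff)
  note lin = this[OF smooth_dd[OF S]]
  have "dd (0, v) (dd (axis i 1, 0) S) p = (mixed_hessian S p *v v) $ i" for i
  proof -
    have "dd (0, v) (dd (axis i 1, 0) S) p
        = dd (0, \<Sum>k\<in>UNIV. v $ k *\<^sub>R axis k 1) (dd (axis i 1, 0) S) p"
      using basis_expansion[of v] by (simp add: scalar_mult_eq_scaleR)
    then show ?thesis
      by (simp add: linear_sum[OF lin] linear_scale[OF lin] matrix_vector_mult_def mixed_hessian_nth mult.commute)
  qed
  then show ?thesis by (simp add: vec_eq_iff)
qed

lemma transpose_mixed_hessian_mult:
  "transpose (mixed_hessian S p) *v v = (\<chi> i. dd (v, 0) (dd (0, axis i 1) S) p)"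
proof -
  have "linear (\<lambda>v. dd (v, 0) f p)" if "smooth_on UNIV f" for f :: "(real^'n) \<times> (real^'n) \<Rightarrow> real"
    using linear_compose[OF _ dd_linear[OF that], of "\<lambda>v. (v, 0)"] by (simp add: o_def linear_iff)
  note lin = this[OF smooth_dd[OF S]]
  have "dd (v, 0) (dd (0, axis i 1) S) p = (transpose (mixed_hessian S p) *v v) $ i" for i
  proof -
    have "dd (v, 0) (dd (0, axis i 1) S) p
        = dd (\<Sum>k\<in>UNIV. v $ k *\<^sub>R axis k 1, 0) (dd (0, axis i 1) S) p"
      using basis_expansion[of v] by (simp add: scalar_mult_eq_scaleR)
    then show ?thesis
      by (simp add: linear_sum[OF lin] linear_scale[OF lin] matrix_vector_mult_def mixed_hessian_nth
          mult.commute transpose_def dd_commute[OF S, of "(axis _ 1, 0)"])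
  qed
  then show ?thesis by (simp add: vec_eq_iff)
qed

lemma smooth_det_mixed_hessian: "smooth_on UNIV (\<lambda>p. det (mixed_hessian S p))"
  by (intro smooth_det smooth_mixed_hessian)

lemma smooth_jac_det_proj_R: "smooth_on UNIV (jac_det (proj_R S))"
proof -
  have "smooth_on UNIV (\<lambda>p. frechet_derivative (proj_R S) (at p) (coord_vec b) \<bullet> coord_vec a)" for a b
  proof (cases a)
    case (Inl i)
    then show ?thesis by (simp add: frechet_proj_R coord_vec_def smooth_const)
  next
    case (Inr i)
    then show ?thesis by (simp add: frechet_proj_R coord_vec_def inner_axis smooth_dd S)
  qed
  then have "smooth_on UNIV (\<lambda>p. jac_det (proj_R S) p)"
    unfolding jac_det_def by (intro smooth_det) simp
  then show ?thesis .
qed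

lemma type_L_pure_derivative:
  assumes "\<forall>p. rank (mixed_hessian S p) \<ge> CARD('n) - 1" "map_type_le (proj_L S) l"
    and "jac_det (proj_L S) p = 0"
  shows "\<exists>w. \<exists>j\<le>l. (dd (0, w) ^^ j) (jac_det (proj_L S)) p \<noteq> 0"
  using assms smooth_det_mixed_hessian
  by (intro type_imp_pure_derivative[where M = "mixed_hessian S"])
    (auto simp: linear_iff inj_def smooth_mixed_hessian frechet_proj_L mixed_hessian_mult jac_det_proj_L[abs_def] zero_prod_def)

lemma type_R_pure_derivative:
  assumes "\<forall>p. rank (mixed_hessian S p) \<ge> CARD('n) - 1" "map_type_le (proj_R S) r"
    and "jac_det (proj_R S) p = 0"
  shows "\<exists>w. \<exists>j\<le>r. (dd (w, 0) ^^ j) (jac_det (proj_R S)) p \<noteq> 0"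
proof (rule type_imp_pure_derivative[where M = "\<lambda>p. transpose (mixed_hessian S p)"])
  fix p and v :: "real^'n"
  assume "transpose (mixed_hessian S p) *v v = 0"
  then show "frechet_derivative (proj_R S) (at p) (v, 0) = 0"
    by (simp only: frechet_proj_R transpose_mixed_hessian_mult) (simp add: zero_prod_def)
next
  show "smooth_on UNIV (\<lambda>p. transpose (mixed_hessian S p) $ i $ j)" for i j
    using smooth_mixed_hessian by (simp add: transpose_def)
qed (use assms smooth_jac_det_proj_R in
  \<open>auto simp: linear_iff inj_def abs_jac_det_proj_R rank_transpose\<close>)

end

section \<open>Sublevel sets\<close>

text \<open>Here \<open>G j\<close> is the \<open>j\<close>-th derivative of \<open>G 0\<close>. If
  \<open>G (Suc k)\<close> is at least \<open>c\<close> in absolute value, the mean value theorem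
  confines the set \<open>J\<close> where \<open>G k\<close> is below \<open>c * \<eta>\<close> to
  diameter \<open>2 * \<eta>\<close>; on either side of it the induction hypothesis applies with
  \<open>c * \<eta>\<close> in place of \<open>c\<close>. A Borel cover is all that the slicing
  argument requires.\<close>

lemma sublevel_1d:
  fixes G :: "nat \<Rightarrow> real \<Rightarrow> real"
  assumes G: "\<And>j s. (G j has_real_derivative G (Suc j) s) (at s)" and \<eta>: "\<eta> > 0"
  shows "c > 0 \<Longrightarrow> is_interval I \<Longrightarrow> (\<And>s. s \<in> I \<Longrightarrow> \<bar>G k s\<bar> \<ge> c) \<Longrightarrow>
    \<exists>A\<in>sets borel. {s\<in>I. \<bar>G 0 s\<bar> < c * \<eta> ^ k} \<subseteq> A \<and> emeasure lborel A \<le> ennreal (4 * (2 ^ k - 1) * \<eta>)"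
proof (induction k arbitrary: c I)
  case 0
  then have "{s\<in>I. \<bar>G 0 s\<bar> < c * \<eta> ^ 0} = {}" by force
  then show ?case by (intro bexI[of _ "{}"]) auto
next
  case (Suc k)
  have mvt: "c * (t - s) \<le> \<bar>G k t - G k s\<bar>" if st: "s \<in> I" "t \<in> I" "s < t" for s t
  proof -
    obtain z where z: "s < z" "z < t" "G k t - G k s = (t - s) * G (Suc k) z"
      using MVT2[OF st(3), of "G k" "G (Suc k)"] G by blast
    then have "z \<in> I" using st Suc.prems(2) by (meson is_interval_1 less_imp_le)
    then have "c * (t - s) \<le> \<bar>G (Suc k) z\<bar> * (t - s)"
      using Suc.prems(3) st by (intro mult_right_mono) auto
    then show ?thesis using z st by (simp add: abs_mult mult.commute)
  qed
  define J where "J = {s\<in>I. \<bar>G k s\<bar> < c * \<eta>}"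
  have J: "\<bar>t - s\<bar> \<le> 2 * \<eta>" if "s \<in> J" "t \<in> J" for s t
  proof -
    have "t - s \<le> 2 * \<eta>" if "s \<in> J" "t \<in> J" for s t
    proof (cases "s < t")
      case True
      then have "c * (t - s) \<le> \<bar>G k t - G k s\<bar>" using mvt that by (auto simp: J_def)
      also have "\<dots> \<le> c * (2 * \<eta>)" using that by (auto simp: J_def)
      finally show ?thesis using Suc.prems(1) by simp
    qed (use \<eta> in simp)
    from this[OF that] this[OF that(2,1)] show ?thesis by simp
  qed
  \<comment> \<open>The points of \<open>I\<close> beyond \<open>J\<close> on either side form
    intervals, and this does not require knowing that \<open>J\<close> is one. If \<open>J\<close>
    is empty, both sets are all of \<open>I\<close>.\<close>
  define I1 where "I1 = {s\<in>I. \<forall>t\<in>J. s < t}"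
  define I2 where "I2 = {s\<in>I. \<forall>t\<in>J. t < s}"
  have I12: "is_interval I1" "is_interval I2"
    using Suc.prems(2) unfolding is_interval_1 I1_def I2_def
    by (blast intro: le_less_trans less_le_trans)+
  have big: "\<bar>G k s\<bar> \<ge> c * \<eta>" if "s \<in> I1 \<union> I2" for s
    using that by (auto simp: I1_def I2_def J_def not_less[symmetric])
  have "c * \<eta> > 0" using Suc.prems(1) \<eta> by simp
  from Suc.IH[OF this I12(1)] big obtain A1 where A1: "A1 \<in> sets borel"
    "{s\<in>I1. \<bar>G 0 s\<bar> < c * \<eta> * \<eta> ^ k} \<subseteq> A1" "emeasure lborel A1 \<le> ennreal (4 * (2 ^ k - 1) * \<eta>)" by blast
  from Suc.IH[OF \<open>c * \<eta> > 0\<close> I12(2)] big obtain A2 where A2: "A2 \<in> sets borel"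
    "{s\<in>I2. \<bar>G 0 s\<bar> < c * \<eta> * \<eta> ^ k} \<subseteq> A2" "emeasure lborel A2 \<le> ennreal (4 * (2 ^ k - 1) * \<eta>)" by blast
  \<comment> \<open>A point in neither set lies between two points of \<open>J\<close>, hence within
    \<open>2 * \<eta>\<close> of any chosen point of \<open>J\<close>. If \<open>J\<close> is empty,
    nothing is left to cover.\<close>
  obtain t0 where t0: "{s\<in>I. s \<notin> I1 \<and> s \<notin> I2} \<subseteq> {t0 - 2 * \<eta>..t0 + 2 * \<eta>}"
  proof (cases "J = {}")
    case False
    then obtain t0 where t0: "t0 \<in> J" by auto
    have "s \<in> {t0 - 2 * \<eta>..t0 + 2 * \<eta>}" if s: "s \<in> I" "s \<notin> I1" "s \<notin> I2" for s
    proof -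
      obtain t t' where "t \<in> J" "t \<le> s" "t' \<in> J" "s \<le> t'"
        using s by (auto simp: I1_def I2_def not_less)
      then show ?thesis using J[OF t0, of t] J[OF t0, of t'] by auto
    qed
    then show ?thesis using that by blast
  qed (use that I1_def in auto)
  let ?A = "A1 \<union> A2 \<union> {t0 - 2 * \<eta>..t0 + 2 * \<eta>}"
  have "{s\<in>I. \<bar>G 0 s\<bar> < c * \<eta> ^ Suc k} \<subseteq> ?A"
    using A1(2) A2(2) t0 by (auto simp: mult.assoc)
  moreover have "emeasure lborel ?A \<le> ennreal (4 * (2 ^ Suc k - 1) * \<eta>)"
  proof -
    have "emeasure lborel ?A \<le> emeasure lborel A1 + emeasure lborel A2 + emeasure lborel {t0 - 2 * \<eta>..t0 + 2 * \<eta>}"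
      using A1(1) A2(1)
      by (intro order_trans[OF emeasure_subadditive] add_right_mono emeasure_subadditive) auto
    also have "\<dots> \<le> ennreal (4 * (2 ^ k - 1) * \<eta>) + ennreal (4 * (2 ^ k - 1) * \<eta>) + ennreal (4 * \<eta>)"
      using A1(3) A2(3) \<eta> by (intro add_mono) auto
    also have "\<dots> = ennreal (4 * (2 ^ k - 1) * \<eta> + 4 * (2 ^ k - 1) * \<eta> + 4 * \<eta>)"
    proof -
      have "0 \<le> 4 * (2 ^ k - 1) * \<eta>" using \<eta> by (intro mult_nonneg_nonneg) auto
      then show ?thesis using \<eta> by (simp only: ennreal_plus add_nonneg_nonneg)
    qed
    \<comment> \<open>The constants solve the recursion \<open>a (k + 1) = 2 * a k + 4\<close> with
      \<open>a 0 = 0\<close>.\<close>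
    also have "4 * (2 ^ k - 1) * \<eta> + 4 * (2 ^ k - 1) * \<eta> + 4 * \<eta> = 4 * (2 ^ Suc k - 1) * \<eta>"
      by (simp add: algebra_simps)
    finally show ?thesis .
  qed
  ultimately show ?case using A1(1) A2(1) by (intro bexI[of _ ?A]) auto
qed

text \<open>Averaging \<open>\<integral>1\<^sub>A(x) = \<integral>1\<^sub>A(x + s w)\<close> over \<open>0 \<le> s \<le> 1\<close> replaces a linear change of variables
  taking \<open>w\<close> to a coordinate direction.\<close>

lemma emeasure_le_of_slices:
  fixes A :: "'a::euclidean_space set"
  assumes A[measurable]: "A \<in> sets borel" and sub: "A \<subseteq> cball x0 R"
    and slice: "\<And>x. \<exists>B\<in>sets borel. {s::real. x + s *\<^sub>R w \<in> A} \<subseteq> B \<and> emeasure lborel B \<le> K"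
  shows "emeasure lborel A \<le> K * emeasure lborel (cball x0 (R + norm w))"
proof -
  let ?I = "{0..1::real}"
  have inv: "(\<integral>\<^sup>+x. indicator A (x + s *\<^sub>R w) \<partial>lborel) = emeasure lborel A" for s :: real
  proof -
    have "emeasure lborel A = (\<integral>\<^sup>+x. indicator A x \<partial>(distr lborel borel ((+) (s *\<^sub>R w))))"
      by (simp add: lborel_distr_plus)
    also have "\<dots> = (\<integral>\<^sup>+x. indicator A (s *\<^sub>R w + x) \<partial>lborel)"
      by (subst nn_integral_distr) auto
    finally show ?thesis by (simp add: add.commute)
  qed
  have "emeasure lborel A = (\<integral>\<^sup>+s. emeasure lborel A * indicator ?I s \<partial>lborel)"
    by (simp add: nn_integral_cmult_indicator)
  also have "\<dots> = (\<integral>\<^sup>+s. (\<integral>\<^sup>+x. indicator A (x + s *\<^sub>R w) * indicator ?I s \<partial>lborel) \<partial>lborel)"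
    by (subst nn_integral_multc) (auto simp: inv)
  also have "\<dots> = (\<integral>\<^sup>+x. (\<integral>\<^sup>+s. indicator A (x + s *\<^sub>R w) * indicator ?I s \<partial>lborel) \<partial>lborel)"
    by (intro lborel_pair.Fubini') (simp add: split_beta')
  \<comment> \<open>A segment \<open>x + s w\<close> with \<open>0 \<le> s \<le> 1\<close> can meet
    \<open>A\<close> only if \<open>x\<close> is within \<open>norm w\<close> of it, so the outer
    integral runs over the enlarged ball.\<close>
  also have "\<dots> \<le> (\<integral>\<^sup>+x. K * indicator (cball x0 (R + norm w)) x \<partial>lborel)"
  proof (rule nn_integral_mono)
    fix x
    obtain B where B: "B \<in> sets borel" "{s. x + s *\<^sub>R w \<in> A} \<subseteq> B" "emeasure lborel B \<le> K"
      using slice by blast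
    show "(\<integral>\<^sup>+s. indicator A (x + s *\<^sub>R w) * indicator ?I s \<partial>lborel) \<le> K * indicator (cball x0 (R + norm w)) x"
    proof (cases "x \<in> cball x0 (R + norm w)")
      case True
      have "(\<integral>\<^sup>+s. indicator A (x + s *\<^sub>R w) * indicator ?I s \<partial>lborel) \<le> (\<integral>\<^sup>+s. indicator B s \<partial>lborel)"
        using B(2) by (intro nn_integral_mono) (auto simp: indicator_def)
      then show ?thesis using True B by auto
    next
      case False
      have zero: "indicator A (x + s *\<^sub>R w) * indicator ?I s = (0::ennreal)" for s
      proof (rule ccontr)
        assume "indicator A (x + s *\<^sub>R w) * indicator ?I s \<noteq> (0::ennreal)"
        then have s: "x + s *\<^sub>R w \<in> A" "0 \<le> s" "s \<le> 1" by (auto simp: indicator_def split: if_splits)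
        have "dist x0 x \<le> dist x0 (x + s *\<^sub>R w) + dist (x + s *\<^sub>R w) x" by (rule dist_triangle)
        also have "dist (x + s *\<^sub>R w) x = s * norm w" using s by (simp add: dist_norm)
        also have "\<dots> \<le> 1 * norm w" using s by (intro mult_right_mono) auto
        finally show False using False s sub by auto
      qed
      show ?thesis unfolding zero by simp
    qed
  qed
  also have "\<dots> = K * emeasure lborel (cball x0 (R + norm w))"
    by (simp add: nn_integral_cmult_indicator)
  finally show ?thesis .
qed

section \<open>Sublevel sets near a point with a nonzero pure derivative\<close>

lemma pure_derivative_lower_bound:
  fixes f :: "'p::euclidean_space \<Rightarrow> real"
  assumes f: "smooth_on UNIV f" and nz: "(dd d ^^ j) f p \<noteq> 0"
  obtains c \<delta> where "c > 0" "\<delta> > 0" "\<And>q. q \<in> ball p \<delta> \<Longrightarrow> \<bar>(dd d ^^ j) f q\<bar> \<ge> c"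
proof -
  have "isCont (\<lambda>q. \<bar>(dd d ^^ j) f q\<bar>) p"
    using smooth_continuous[OF smooth_dd_pow[OF f]]
    by (intro continuous_intros) (simp add: continuous_on_eq_continuous_at)
  then have "((\<lambda>q. \<bar>(dd d ^^ j) f q\<bar>) \<longlongrightarrow> \<bar>(dd d ^^ j) f p\<bar>) (nhds p)"
    using tendsto_at_iff_tendsto_nhds[of "\<lambda>q. \<bar>(dd d ^^ j) f q\<bar>" p] by (simp add: isCont_def)
  then have "\<forall>\<^sub>F q in nhds p. \<bar>(dd d ^^ j) f q\<bar> > \<bar>(dd d ^^ j) f p\<bar> / 2"
    by (rule order_tendstoD(1)) (use nz in auto)
  then obtain \<delta> where "\<delta> > 0" "\<And>q. dist q p < \<delta> \<Longrightarrow> \<bar>(dd d ^^ j) f q\<bar> > \<bar>(dd d ^^ j) f p\<bar> / 2"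
    unfolding eventually_nhds_metric by blast
  then show ?thesis
    using nz by (intro that[of "\<bar>(dd d ^^ j) f p\<bar> / 2" \<delta>]) (auto simp: dist_commute less_imp_le)
qed

text \<open>By convexity a line meets the ball in an interval, where the one-dimensional estimate
  applies. The bound does not depend on the base point \<open>q\<close>, as integration over
  parallel lines requires.\<close>

lemma sublevel_along_line:
  fixes f :: "'p::euclidean_space \<Rightarrow> real"
  assumes f: "smooth_on UNIV f" and c: "c > 0" and \<eta>: "\<eta> > 0"
    and lower: "\<And>q. q \<in> ball p \<delta> \<Longrightarrow> \<bar>(dd d ^^ j) f q\<bar> \<ge> c"
  shows "\<exists>A\<in>sets borel. {s. q + s *\<^sub>R d \<in> ball p \<delta> \<and> \<bar>f (q + s *\<^sub>R d)\<bar> < c * \<eta> ^ j} \<subseteq> A \<and>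
    emeasure lborel A \<le> ennreal (4 * 2 ^ j * \<eta>)"
proof -
  define G where "G i s = (dd d ^^ i) f (q + s *\<^sub>R d)" for i s
  define I where "I = {s. q + s *\<^sub>R d \<in> ball p \<delta>}"
  have "(G i has_real_derivative G (Suc i) s) (at s)" for i s
    unfolding G_def[abs_def] using has_real_derivative_along_line[OF smooth_dd_pow[OF f]] by simp
  moreover have "is_interval I"
  proof -
    have "convex ((\<lambda>s. q + s *\<^sub>R d) -` ball p \<delta>)"
      unfolding convex_def
    proof (intro ballI allI impI)
      fix s t u v :: real
      assume st: "s \<in> (\<lambda>s. q + s *\<^sub>R d) -` ball p \<delta>" "t \<in> (\<lambda>s. q + s *\<^sub>R d) -` ball p \<delta>"
        and uv: "0 \<le> u" "0 \<le> v" "u + v = 1"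
      have "q + (u *\<^sub>R s + v *\<^sub>R t) *\<^sub>R d = u *\<^sub>R (q + s *\<^sub>R d) + v *\<^sub>R (q + t *\<^sub>R d)"
        using uv(3) by (simp add: algebra_simps flip: scaleR_add_left)
      also have "\<dots> \<in> ball p \<delta>"
        using st uv convexD[OF convex_ball] by blast
      finally show "u *\<^sub>R s + v *\<^sub>R t \<in> (\<lambda>s. q + s *\<^sub>R d) -` ball p \<delta>" by simp
    qed
    then show ?thesis by (simp add: I_def is_interval_convex_1 vimage_def)
  qed
  moreover have "\<bar>G j s\<bar> \<ge> c" if "s \<in> I" for s
    using that lower by (simp add: G_def I_def)
  ultimately obtain A where A: "A \<in> sets borel" "{s\<in>I. \<bar>G 0 s\<bar> < c * \<eta> ^ j} \<subseteq> A"
      "emeasure lborel A \<le> ennreal (4 * (2 ^ j - 1) * \<eta>)"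
    using sublevel_1d[of G \<eta> c I j] \<eta> c by blast
  have "emeasure lborel A \<le> ennreal (4 * 2 ^ j * \<eta>)"
    using \<eta> by (intro order_trans[OF A(3)] ennreal_leI) auto
  then show ?thesis using A by (intro bexI[of _ A]) (auto simp: G_def I_def)
qed

text \<open>Captures the sections of the product by fixing either variable: \<open>e x\<close>
  parametrizes a section, \<open>\<iota>\<close> embeds its directions, \<open>pr\<close> returns
  its coordinate. The distance condition places the part of any section inside
  \<open>ball p \<delta>\<close> within the same ball around \<open>pr p\<close>, whatever
  \<open>x\<close> is.\<close>

locale line_sections =
  fixes e :: "'x \<Rightarrow> 'b::euclidean_space \<Rightarrow> 'p::euclidean_space" and \<iota> :: "'b \<Rightarrow> 'p" and pr :: "'p \<Rightarrow> 'b"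
  assumes e_line: "e x (\<theta> + s *\<^sub>R w) = e x \<theta> + s *\<^sub>R \<iota> w"
    and e_cont: "continuous_on UNIV (e x)"
    and e_dist: "dist (pr p) \<theta> \<le> dist p (e x \<theta>)"
begin

lemma section_set_measurable:
  fixes f :: "'p \<Rightarrow> real"
  assumes "smooth_on UNIV f" "B \<in> sets borel"
  shows "{\<theta>. e x \<theta> \<in> B \<and> \<bar>f (e x \<theta>)\<bar> \<le> a} \<in> sets borel"
    and "{\<theta>. e x \<theta> \<in> B \<and> \<bar>f (e x \<theta>)\<bar> < a} \<in> sets borel"
proof -
  have [measurable]: "e x \<in> borel_measurable borel" "f \<in> borel_measurable borel" "B \<in> sets borel"
    using e_cont smooth_continuous[OF assms(1)] assms(2) by (auto intro: borel_measurable_continuous_onI)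
  show "{\<theta>. e x \<theta> \<in> B \<and> \<bar>f (e x \<theta>)\<bar> \<le> a} \<in> sets borel" "{\<theta>. e x \<theta> \<in> B \<and> \<bar>f (e x \<theta>)\<bar> < a} \<in> sets borel"
    by measurable
qed

text \<open>For small \<open>\<epsilon>\<close> the line estimate is used with \<open>\<eta>\<close>
  proportional to \<open>\<epsilon> powr (1 / m)\<close>; as \<open>j \<le> m\<close>,
  \<open>\<eta> ^ j\<close> still dominates a multiple of \<open>\<epsilon>\<close>. For large
  \<open>\<epsilon>\<close> the volume \<open>N\<close> of a fixed ball is enough.\<close>

lemma local_sublevel:
  fixes f :: "'p \<Rightarrow> real"
  assumes f: "smooth_on UNIV f" and j: "j \<le> m" "m \<ge> 1" and nz: "(dd (\<iota> w) ^^ j) f p \<noteq> 0"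
  shows "\<exists>\<delta>>0. \<exists>C\<ge>0. \<forall>x. \<forall>\<epsilon>>0.
    emeasure lborel {\<theta>. e x \<theta> \<in> ball p \<delta> \<and> \<bar>f (e x \<theta>)\<bar> \<le> 2 * \<epsilon>} \<le> ennreal (C * \<epsilon> powr (1 / real m))"
proof -
  obtain c \<delta> where c: "c > 0" and \<delta>: "\<delta> > 0" and lower: "\<And>q. q \<in> ball p \<delta> \<Longrightarrow> \<bar>(dd (\<iota> w) ^^ j) f q\<bar> \<ge> c"
    using pure_derivative_lower_bound[OF f nz] by metis
  let ?E = "\<lambda>x \<epsilon>. {\<theta>. e x \<theta> \<in> ball p \<delta> \<and> \<bar>f (e x \<theta>)\<bar> \<le> 2 * \<epsilon>}"
  define N where "N = measure lborel (cball (pr p) (\<delta> + norm w))"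
  have N: "emeasure lborel (cball (pr p) (\<delta> + norm w)) = ennreal N"
    unfolding N_def using emeasure_lborel_cball_finite[of "pr p" "\<delta> + norm w"]
    by (intro emeasure_eq_ennreal_measure) (simp add: less_top)
  have sub: "{\<theta>. e x \<theta> \<in> ball p \<delta> \<and> P \<theta>} \<subseteq> cball (pr p) \<delta>" for x P
  proof
    fix \<theta> assume "\<theta> \<in> {\<theta>. e x \<theta> \<in> ball p \<delta> \<and> P \<theta>}"
    then show "\<theta> \<in> cball (pr p) \<delta>" using e_dist[where p = p and x = x and \<theta> = \<theta>] by simp
  qed
  have trivial: "emeasure lborel (?E x \<epsilon>) \<le> ennreal N" for x \<epsilon>
  proof -
    have "?E x \<epsilon> \<subseteq> cball (pr p) (\<delta> + norm w)"
      using sub[of x] subset_cball[of \<delta> "\<delta> + norm w"] by force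
    then show ?thesis unfolding N[symmetric] by (intro emeasure_mono) auto
  qed
  have main: "emeasure lborel (?E x \<epsilon>) \<le> ennreal (4 * 2 ^ j * N * \<eta>)" if "\<eta> > 0" "2 * \<epsilon> < c * \<eta> ^ j" for x \<epsilon> \<eta>
  proof -
    let ?F = "{\<theta>. e x \<theta> \<in> ball p \<delta> \<and> \<bar>f (e x \<theta>)\<bar> < c * \<eta> ^ j}"
    have F: "?F \<in> sets borel" by (rule section_set_measurable(2)[OF f]) simp
    have "emeasure lborel (?E x \<epsilon>) \<le> emeasure lborel ?F"
      using that F by (intro emeasure_mono) auto
    also have "\<dots> \<le> ennreal (4 * 2 ^ j * \<eta>) * emeasure lborel (cball (pr p) (\<delta> + norm w))"
    proof (rule emeasure_le_of_slices[OF F sub])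
      fix \<theta>
      show "\<exists>B\<in>sets borel. {s. \<theta> + s *\<^sub>R w \<in> ?F} \<subseteq> B \<and> emeasure lborel B \<le> ennreal (4 * 2 ^ j * \<eta>)"
        unfolding mem_Collect_eq e_line by (rule sublevel_along_line[OF f c that(1) lower])
    qed
    also have "\<dots> = ennreal (4 * 2 ^ j * N * \<eta>)"
      unfolding N using that by (subst ennreal_mult[symmetric]) (auto simp: N_def mult_ac)
    finally show ?thesis .
  qed
  obtain c0 C0 where c0: "c0 > 0" "C0 \<ge> 0"
    and small: "\<And>x \<epsilon>. 0 < \<epsilon> \<Longrightarrow> \<epsilon> < c0 \<Longrightarrow> emeasure lborel (?E x \<epsilon>) \<le> ennreal (C0 * \<epsilon> powr (1 / real m))"
  \<comment> \<open>For \<open>j = 0\<close> the function itself is at least \<open>c\<close> near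
    \<open>p\<close>, so small sublevel sets are empty.\<close>
  proof (cases "j = 0")
    case True
    have "emeasure lborel (?E x \<epsilon>) \<le> ennreal (0 * \<epsilon> powr (1 / real m))" if "\<epsilon> < c / 2" for x \<epsilon>
    proof -
      have empty: "?E x \<epsilon> = {}" using that lower True by fastforce
      show ?thesis unfolding empty by simp
    qed
    then show ?thesis using c by (intro that[of "c / 2" 0]) auto
  next
    case False
    \<comment> \<open>With \<open>j \<ge> 1\<close>, \<open>a \<ge> 1\<close> gives
      \<open>a ^ j \<ge> a\<close>, and \<open>c * a \<ge> 3\<close> then yields
      \<open>c * \<eta> ^ j \<ge> 3 * \<epsilon>\<close>, strictly above
      \<open>2 * \<epsilon>\<close> as \<open>main\<close> demands.\<close>
    define a where "a = max 1 (3 / c)"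
    have a: "a \<ge> 1" "3 / c \<le> a" by (auto simp: a_def)
    have "emeasure lborel (?E x \<epsilon>) \<le> ennreal (4 * 2 ^ j * N * a * \<epsilon> powr (1 / real m))" if \<epsilon>: "0 < \<epsilon>" "\<epsilon> < 1" for x \<epsilon>
    proof -
      let ?\<eta> = "a * \<epsilon> powr (1 / real m)"
      have "a ^ 1 \<le> a ^ j" using a False by (intro power_increasing) auto
      moreover have "\<epsilon> powr 1 \<le> \<epsilon> powr (real j / real m)"
        using j \<epsilon> by (intro powr_mono') auto
      ultimately have "a * \<epsilon> \<le> a ^ j * \<epsilon> powr (real j / real m)"
        using a \<epsilon> by (intro mult_mono) auto
      also have "\<dots> = ?\<eta> ^ j"
        using \<epsilon> by (simp add: power_mult_distrib powr_power)
      finally have "c * (a * \<epsilon>) \<le> c * ?\<eta> ^ j" using c by (intro mult_left_mono) auto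
      moreover have "3 \<le> c * a" using a(2) c by (simp add: field_simps)
      then have "3 * \<epsilon> \<le> c * (a * \<epsilon>)" using \<epsilon> mult_right_mono[of 3 "c * a" \<epsilon>] by (simp add: mult_ac)
      ultimately have "2 * \<epsilon> < c * ?\<eta> ^ j" using \<epsilon> by linarith
      then show ?thesis using main[of ?\<eta> \<epsilon> x] a \<epsilon> by (simp add: mult_ac)
    qed
    then show ?thesis using a by (intro that[of 1 "4 * 2 ^ j * N * a"]) (auto simp: N_def)
  qed
  have "emeasure lborel (?E x \<epsilon>) \<le> ennreal ((C0 + N * (1 / c0) powr (1 / real m)) * \<epsilon> powr (1 / real m))"
    if \<epsilon>: "\<epsilon> > 0" for x \<epsilon>
  proof (cases "\<epsilon> < c0")
    case True
    show ?thesis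
      using c0 \<epsilon> by (intro order_trans[OF small[OF \<epsilon> True]] ennreal_leI mult_right_mono) (auto simp: N_def)
  next
    case False
    \<comment> \<open>Above the threshold \<open>c0\<close> this factor is at least 1, so it absorbs
      the trivial bound \<open>N\<close>.\<close>
    have "1 \<le> (\<epsilon> / c0) powr (1 / real m)" using False c0 \<epsilon> by (intro ge_one_powr_ge_zero) auto
    also have "\<dots> = (1 / c0) powr (1 / real m) * \<epsilon> powr (1 / real m)"
      using c0 \<epsilon> by (simp flip: powr_mult)
    finally have "N * 1 \<le> N * ((1 / c0) powr (1 / real m) * \<epsilon> powr (1 / real m))"
      by (intro mult_left_mono) (auto simp: N_def)
    also have "\<dots> \<le> (C0 + N * (1 / c0) powr (1 / real m)) * \<epsilon> powr (1 / real m)"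
      using c0 by (simp add: algebra_simps)
    finally show ?thesis using trivial[of x \<epsilon>] by (intro order_trans[OF trivial] ennreal_leI) simp
  qed
  then show ?thesis
    using \<delta> c0 by (intro exI[of _ \<delta>] conjI exI[of _ "C0 + N * (1 / c0) powr (1 / real m)"]) (auto simp: N_def)
qed

text \<open>Finitely many of the local balls cover \<open>K\<close>, and their constants add up;
  each is already uniform in \<open>x\<close> and \<open>\<epsilon>\<close>.\<close>

lemma uniform_sublevel:
  fixes f :: "'p \<Rightarrow> real"
  assumes f: "smooth_on UNIV f" and m: "m \<ge> 1" and K: "compact K"
    and nz: "\<And>p. f p = 0 \<Longrightarrow> \<exists>w. \<exists>j\<le>m. (dd (\<iota> w) ^^ j) f p \<noteq> 0"
  shows "\<exists>C\<ge>0. \<forall>x. \<forall>\<epsilon>>0.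
    emeasure lborel {\<theta>. e x \<theta> \<in> K \<and> \<bar>f (e x \<theta>)\<bar> \<le> 2 * \<epsilon>} \<le> ennreal (C * \<epsilon> powr (1 / real m))"
proof -
  \<comment> \<open>Where \<open>f p \<noteq> 0\<close>, the derivative of order 0 serves, with any
    direction.\<close>
  have pure: "\<exists>w. \<exists>j\<le>m. (dd (\<iota> w) ^^ j) f p \<noteq> 0" for p
  proof (cases "f p = 0")
    case False
    then show ?thesis by (intro exI[of _ "0 :: 'b"] exI[of _ "0 :: nat"]) simp
  qed (rule nz)
  define bound where "bound p \<delta> C \<longleftrightarrow> (\<forall>x. \<forall>\<epsilon>>0.
    emeasure lborel {\<theta>. e x \<theta> \<in> ball p \<delta> \<and> \<bar>f (e x \<theta>)\<bar> \<le> 2 * \<epsilon>} \<le> ennreal (C * \<epsilon> powr (1 / real m)))"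
    for p \<delta> C
  have "\<exists>\<delta>>0. \<exists>C\<ge>0. bound p \<delta> C" for p
    unfolding bound_def using local_sublevel[OF f _ m] pure by blast
  then obtain \<delta> C where \<delta>: "\<And>p. \<delta> p > 0" and C: "\<And>p. C p \<ge> 0" and loc: "\<And>p. bound p (\<delta> p) (C p)"
    by metis
  obtain T where T: "finite T" "K \<subseteq> (\<Union>p\<in>T. ball p (\<delta> p))"
  proof -
    have cover: "K \<subseteq> (\<Union>p\<in>K. ball p (\<delta> p))" using \<delta> by force
    show ?thesis
      by (rule compactE_image[where f = "\<lambda>p. ball p (\<delta> p)", OF K open_ball cover]) (rule that)
  qed
  have "emeasure lborel {\<theta>. e x \<theta> \<in> K \<and> \<bar>f (e x \<theta>)\<bar> \<le> 2 * \<epsilon>} \<le> ennreal ((\<Sum>p\<in>T. C p) * \<epsilon> powr (1 / real m))"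
    if "\<epsilon> > 0" for x \<epsilon>
  proof -
    let ?E = "\<lambda>p. {\<theta>. e x \<theta> \<in> ball p (\<delta> p) \<and> \<bar>f (e x \<theta>)\<bar> \<le> 2 * \<epsilon>}"
    have E: "?E p \<in> sets borel" for p by (rule section_set_measurable(1)[OF f]) simp
    have "emeasure lborel {\<theta>. e x \<theta> \<in> K \<and> \<bar>f (e x \<theta>)\<bar> \<le> 2 * \<epsilon>} \<le> emeasure lborel (\<Union>p\<in>T. ?E p)"
    proof (rule emeasure_mono)
      show "{\<theta>. e x \<theta> \<in> K \<and> \<bar>f (e x \<theta>)\<bar> \<le> 2 * \<epsilon>} \<subseteq> (\<Union>p\<in>T. ?E p)" using T(2) by blast
    qed (use T E in auto)
    also have "\<dots> \<le> (\<Sum>p\<in>T. emeasure lborel (?E p))"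
      using T E by (intro emeasure_subadditive_finite) auto
    also have "\<dots> \<le> (\<Sum>p\<in>T. ennreal (C p * \<epsilon> powr (1 / real m)))"
      using loc that unfolding bound_def by (intro sum_mono) blast
    also have "\<dots> = ennreal ((\<Sum>p\<in>T. C p) * \<epsilon> powr (1 / real m))"
      using C by (subst sum_ennreal) (auto simp: sum_distrib_right)
    finally show ?thesis .
  qed
  then show ?thesis using C by (intro exI[of _ "\<Sum>p\<in>T. C p"]) (auto intro: sum_nonneg)
qed

end

section \<open>Operator bounds\<close>

lemma op_norm_leI:
  assumes "\<And>u. u \<in> borel_measurable lborel \<Longrightarrow> N u < \<infinity> \<Longrightarrow>
    A u \<in> borel_measurable lborel \<and> N (A u) \<le> K * N u"
  shows "op_norm N A \<le> K"
  unfolding op_norm_def using assms by (intro Inf_lower) blast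

text \<open>No integrability is assumed: the Bochner integral of a nonintegrable function is 0 by
  convention.\<close>

lemma norm_integral_le_nn_integral:
  fixes f :: "'a \<Rightarrow> complex"
  shows "ennreal (norm (\<integral>x. f x \<partial>M)) \<le> (\<integral>\<^sup>+x. ennreal (norm (f x)) \<partial>M)"
  by (cases "integrable M f") (auto intro: integral_norm_bound_ennreal simp: not_integrable_integral_eq)

context
  fixes k :: "'a::euclidean_space \<times> 'b::euclidean_space \<Rightarrow> complex"
  assumes k[measurable]: "k \<in> borel_measurable borel"
begin

lemma kernel_op_measurable:
  assumes [measurable]: "u \<in> borel_measurable lborel"
  shows "(\<lambda>x. \<integral>\<theta>. k (x, \<theta>) * u \<theta> \<partial>lborel) \<in> borel_measurable lborel"
  by measurable

text \<open>Tonelli's theorem puts the \<open>x\<close>-integral inside, so the kernel is integrated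
  in \<open>x\<close> with \<open>\<theta>\<close> fixed.\<close>

lemma L1_kernel_op_le:
  assumes K: "\<And>\<theta>. (\<integral>\<^sup>+x. ennreal (norm (k (x, \<theta>))) \<partial>lborel) \<le> K"
    and u[measurable]: "u \<in> borel_measurable lborel"
  shows "L1_norm (\<lambda>x. \<integral>\<theta>. k (x, \<theta>) * u \<theta> \<partial>lborel) \<le> K * L1_norm u"
proof -
  have "L1_norm (\<lambda>x. \<integral>\<theta>. k (x, \<theta>) * u \<theta> \<partial>lborel)
      \<le> (\<integral>\<^sup>+x. (\<integral>\<^sup>+\<theta>. ennreal (norm (k (x, \<theta>) * u \<theta>)) \<partial>lborel) \<partial>lborel)"
    unfolding L1_norm_def by (intro nn_integral_mono norm_integral_le_nn_integral)
  also have "\<dots> = (\<integral>\<^sup>+\<theta>. (\<integral>\<^sup>+x. ennreal (norm (k (x, \<theta>) * u \<theta>)) \<partial>lborel) \<partial>lborel)"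
    by (intro lborel_pair.Fubini') measurable
  also have "\<dots> = (\<integral>\<^sup>+\<theta>. (\<integral>\<^sup>+x. ennreal (norm (k (x, \<theta>))) \<partial>lborel) * ennreal (norm (u \<theta>)) \<partial>lborel)"
    by (simp add: norm_mult ennreal_mult nn_integral_multc)
  also have "\<dots> \<le> (\<integral>\<^sup>+\<theta>. K * ennreal (norm (u \<theta>)) \<partial>lborel)"
    using K by (intro nn_integral_mono mult_right_mono) auto
  also have "\<dots> = K * L1_norm u"
    by (simp add: L1_norm_def nn_integral_cmult)
  finally show ?thesis .
qed

lemma Linf_kernel_op_le:
  assumes K: "\<And>x. (\<integral>\<^sup>+\<theta>. ennreal (norm (k (x, \<theta>))) \<partial>lborel) \<le> K"
    and u[measurable]: "u \<in> borel_measurable lborel"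
  shows "Linf_norm (\<lambda>x. \<integral>\<theta>. k (x, \<theta>) * u \<theta> \<partial>lborel) \<le> K * Linf_norm u"
proof -
  have "ennreal (norm (\<integral>\<theta>. k (x, \<theta>) * u \<theta> \<partial>lborel)) \<le> K * Linf_norm u" for x
  proof -
    have ae: "AE \<theta> in lborel. ennreal (norm (u \<theta>)) \<le> Linf_norm u"
      unfolding Linf_norm_def by (rule esssup_AE)
    have "ennreal (norm (\<integral>\<theta>. k (x, \<theta>) * u \<theta> \<partial>lborel))
        \<le> (\<integral>\<^sup>+\<theta>. ennreal (norm (k (x, \<theta>) * u \<theta>)) \<partial>lborel)"
      by (rule norm_integral_le_nn_integral)
    also have "\<dots> \<le> (\<integral>\<^sup>+\<theta>. ennreal (norm (k (x, \<theta>))) * Linf_norm u \<partial>lborel)"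
      using ae by (intro nn_integral_mono_AE, elim eventually_mono) (auto simp: norm_mult ennreal_mult intro: mult_left_mono)
    also have "\<dots> = (\<integral>\<^sup>+\<theta>. ennreal (norm (k (x, \<theta>))) \<partial>lborel) * Linf_norm u"
      by (rule nn_integral_multc) measurable
    also have "\<dots> \<le> K * Linf_norm u" using K by (intro mult_right_mono) auto
    finally show ?thesis .
  qed
  moreover have "(\<lambda>x. ennreal (norm (\<integral>\<theta>. k (x, \<theta>) * u \<theta> \<partial>lborel))) \<in> borel_measurable lborel"
    using kernel_op_measurable[OF u] by measurable
  ultimately show ?thesis unfolding Linf_norm_def[of "\<lambda>x. \<integral>\<theta>. k (x, \<theta>) * u \<theta> \<partial>lborel"]
    by (intro esssup_I) auto
qed

end

section \<open>Application to the oscillatory kernel\<close>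

lemma notin_supp: "p \<notin> supp f \<Longrightarrow> f p = 0"
  unfolding supp_def using closure_subset[of "{x. f x \<noteq> 0}"] by blast

lemma continuous_compact_supp_bounded:
  fixes f :: "'a::topological_space \<Rightarrow> 'b::real_normed_vector"
  assumes "continuous_on UNIV f" "compact (supp f)"
  obtains B where "B \<ge> 0" "\<And>p. norm (f p) \<le> B"
proof -
  have "bounded (f ` supp f)"
    using assms by (intro compact_imp_bounded compact_continuous_image) (auto intro: continuous_on_subset)
  then obtain B where B: "B > 0" "\<And>p. p \<in> supp f \<Longrightarrow> norm (f p) \<le> B"
    by (auto simp: bounded_pos)
  show ?thesis
  proof (rule that[of B])
    show "norm (f p) \<le> B" for p using B notin_supp[of p f] by (cases "p \<in> supp f") auto
  qed (use B in auto)
qed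

lemma sublevel_measure_L:
  fixes S :: "(real^'n) \<times> (real^'n) \<Rightarrow> real"
  assumes S: "smooth_on UNIV S" and rank: "\<forall>p. rank (mixed_hessian S p) \<ge> CARD('n) - 1"
    and type: "map_type_le (proj_L S) l" and l: "l \<ge> 1" and K: "compact K"
  shows "\<exists>C\<ge>0. \<forall>x. \<forall>\<epsilon>>0. emeasure lborel {\<theta>. (x, \<theta>) \<in> K \<and> \<bar>det (mixed_hessian S (x, \<theta>))\<bar> \<le> 2 * \<epsilon>}
    \<le> ennreal (C * \<epsilon> powr (1 / real l))"
proof -
  interpret line_sections "\<lambda>x \<theta> :: real^'n. (x :: real^'n, \<theta>)" "\<lambda>w. (0, w)" snd
    by unfold_locales (auto intro!: continuous_intros dist_snd_le[of _ "(_, _)", simplified])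
  have "jac_det (proj_L S) = (\<lambda>p. det (mixed_hessian S p))"
    using jac_det_proj_L[OF S] by blast
  then show ?thesis
    using uniform_sublevel[OF smooth_det_mixed_hessian[OF S] l K] type_L_pure_derivative[OF S rank type]
    by simp
qed

text \<open>The function used is the Jacobian determinant of the right projection; sublevel sets see
  only its absolute value, which is that of \<open>det (mixed_hessian S p)\<close>.\<close>

lemma sublevel_measure_R:
  fixes S :: "(real^'n) \<times> (real^'n) \<Rightarrow> real"
  assumes S: "smooth_on UNIV S" and rank: "\<forall>p. rank (mixed_hessian S p) \<ge> CARD('n) - 1"
    and type: "map_type_le (proj_R S) r" and r: "r \<ge> 1" and K: "compact K"
  shows "\<exists>C\<ge>0. \<forall>\<theta>. \<forall>\<epsilon>>0. emeasure lborel {x. (x, \<theta>) \<in> K \<and> \<bar>det (mixed_hessian S (x, \<theta>))\<bar> \<le> 2 * \<epsilon>}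
    \<le> ennreal (C * \<epsilon> powr (1 / real r))"
proof -
  interpret line_sections "\<lambda>\<theta> x :: real^'n. (x, \<theta> :: real^'n)" "\<lambda>w. (w, 0)" fst
    by unfold_locales (auto intro!: continuous_intros dist_fst_le[of _ "(_, _)", simplified])
  show ?thesis
    using uniform_sublevel[OF smooth_jac_det_proj_R[OF S] r K] type_R_pure_derivative[OF S rank type]
    by (simp add: abs_jac_det_proj_R[OF S])
qed

text \<open>The oscillating factor has modulus 1, so the kernel is at most \<open>B\<close> and
  lives where \<open>p\<close> is in \<open>supp \<psi>\<close> and the determinant is at most
  \<open>2 * \<epsilon>\<close> in absolute value, for either sign of \<open>t\<close>. Fixing
  \<open>x\<close> gives the sup-norm bound with exponent \<open>1/l\<close>, fixing
  \<open>\<theta>\<close> the \<open>L1\<close> bound with exponent \<open>1/r\<close>.\<close>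

lemma osc_op_bounds:
  fixes S :: "(real^'n) \<times> (real^'n) \<Rightarrow> real"
  assumes S: "smooth_on UNIV S" and \<psi>: "smooth_on UNIV \<psi>" "compact (supp \<psi>)"
    and \<beta>: "smooth_on UNIV \<beta>" "supp \<beta> \<subseteq> {-2..2}"
    and rank: "\<forall>p. rank (mixed_hessian S p) \<ge> CARD('n) - 1" and lr: "l \<ge> 1" "r \<ge> 1"
    and type: "map_type_le (proj_L S) l" "map_type_le (proj_R S) r"
  shows "\<exists>C\<ge>0. \<forall>lam. \<forall>\<epsilon>>0. \<forall>t\<in>{\<epsilon>, -\<epsilon>}.
    op_norm L1_norm (osc_op S \<psi> \<beta> lam t) \<le> ennreal (C * \<epsilon> powr (1 / real r)) \<and>
    op_norm Linf_norm (osc_op S \<psi> \<beta> lam t) \<le> ennreal (C * \<epsilon> powr (1 / real l))"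
proof -
  let ?h = "\<lambda>p. det (mixed_hessian S p)"
  obtain CL where CL: "CL \<ge> 0" "\<And>x \<epsilon>. \<epsilon> > 0 \<Longrightarrow>
      emeasure lborel {\<theta>. (x, \<theta>) \<in> supp \<psi> \<and> \<bar>?h (x, \<theta>)\<bar> \<le> 2 * \<epsilon>} \<le> ennreal (CL * \<epsilon> powr (1 / real l))"
    using sublevel_measure_L[OF S rank type(1) lr(1) \<psi>(2)] by blast
  obtain CR where CR: "CR \<ge> 0" "\<And>\<theta> \<epsilon>. \<epsilon> > 0 \<Longrightarrow>
      emeasure lborel {x. (x, \<theta>) \<in> supp \<psi> \<and> \<bar>?h (x, \<theta>)\<bar> \<le> 2 * \<epsilon>} \<le> ennreal (CR * \<epsilon> powr (1 / real r))"
    using sublevel_measure_R[OF S rank type(2) lr(2) \<psi>(2)] by blast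
  obtain B\<psi> where B\<psi>: "B\<psi> \<ge> 0" "\<And>p. norm (\<psi> p) \<le> B\<psi>"
    using continuous_compact_supp_bounded[OF smooth_continuous[OF \<psi>(1)] \<psi>(2)] by blast
  have "compact ({-2..2} \<inter> supp \<beta>)" by (intro compact_Int_closed) (auto simp: supp_def)
  then have "compact (supp \<beta>)" using \<beta>(2) by (simp add: Int_absorb1)
  then obtain B\<beta> where B\<beta>: "B\<beta> \<ge> 0" "\<And>p. norm (\<beta> p) \<le> B\<beta>"
    using continuous_compact_supp_bounded[OF smooth_continuous[OF \<beta>(1)]] by blast
  define B where "B = B\<psi> * B\<beta>"
  have B0: "B \<ge> 0" using B\<psi> B\<beta> by (simp add: B_def)
  have [measurable]: "S \<in> borel_measurable borel" "\<psi> \<in> borel_measurable borel" "\<beta> \<in> borel_measurable borel"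
      "?h \<in> borel_measurable borel" "supp \<psi> \<in> sets borel"
    using smooth_continuous S \<psi>(1) \<beta>(1) smooth_det_mixed_hessian[OF S]
    by (auto intro: borel_measurable_continuous_onI simp: supp_def)
  have main: "op_norm L1_norm (osc_op S \<psi> \<beta> lam t) \<le> ennreal (B * CR * \<epsilon> powr (1 / real r)) \<and>
      op_norm Linf_norm (osc_op S \<psi> \<beta> lam t) \<le> ennreal (B * CL * \<epsilon> powr (1 / real l))"
    if \<epsilon>: "\<epsilon> > 0" and t: "t \<in> {\<epsilon>, -\<epsilon>}" for lam \<epsilon> t
  proof -
    define k where "k p = exp (\<i> * complex_of_real (lam * S p)) * \<psi> p * \<beta> (inverse t * ?h p)" for p
    have [measurable]: "k \<in> borel_measurable borel" unfolding k_def[abs_def] by measurable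
    let ?E = "{p. p \<in> supp \<psi> \<and> \<bar>?h p\<bar> \<le> 2 * \<epsilon>}"
    have [measurable]: "?E \<in> sets borel" by measurable
    have k_le: "ennreal (norm (k p)) \<le> ennreal B * indicator ?E p" for p
    proof (cases "k p = 0")
      case False
      then have "\<psi> p \<noteq> 0" "\<beta> (inverse t * ?h p) \<noteq> 0" by (auto simp: k_def)
      then have "p \<in> supp \<psi>" "inverse t * ?h p \<in> {-2..2}"
        using notin_supp \<beta>(2) by blast+
      moreover have "\<bar>inverse t * ?h p\<bar> = \<bar>?h p\<bar> / \<epsilon>"
        using t \<epsilon> by (auto simp: abs_mult field_simps)
      ultimately have "\<bar>?h p\<bar> / \<epsilon> \<le> 2" by auto
      then have "p \<in> ?E" using \<open>p \<in> supp \<psi>\<close> \<epsilon> by (simp add: field_simps)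
      moreover have "norm (k p) \<le> B"
      proof -
        have "norm (\<psi> p) * norm (\<beta> (inverse t * ?h p)) \<le> B\<psi> * B\<beta>"
          using B\<psi>(1) by (intro mult_mono B\<psi>(2) B\<beta>(2)) auto
        then show ?thesis by (simp add: k_def B_def norm_mult)
      qed
      ultimately show ?thesis by (simp add: ennreal_leI)
    qed simp
    have osc: "osc_op S \<psi> \<beta> lam t = (\<lambda>u x. \<integral>\<theta>. k (x, \<theta>) * u \<theta> \<partial>lborel)"
      by (simp add: osc_op_def k_def fun_eq_iff)
    have L: "(\<integral>\<^sup>+\<theta>. ennreal (norm (k (x, \<theta>))) \<partial>lborel) \<le> ennreal (B * CL * \<epsilon> powr (1 / real l))" for x
    proof -
      have "(\<integral>\<^sup>+\<theta>. ennreal (norm (k (x, \<theta>))) \<partial>lborel) \<le> (\<integral>\<^sup>+\<theta>. ennreal B * indicator ?E (x, \<theta>) \<partial>lborel)"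
        by (intro nn_integral_mono k_le)
      also have "\<dots> = (\<integral>\<^sup>+\<theta>. ennreal B * indicator {\<theta>. (x, \<theta>) \<in> ?E} \<theta> \<partial>lborel)"
        by (simp add: indicator_def)
      also have "\<dots> = ennreal B * emeasure lborel {\<theta>. (x, \<theta>) \<in> ?E}"
        by (intro nn_integral_cmult_indicator) measurable
      also have "\<dots> \<le> ennreal B * ennreal (CL * \<epsilon> powr (1 / real l))"
        using CL(2)[OF \<epsilon>, of x] by (intro mult_left_mono) auto
      also have "\<dots> = ennreal (B * CL * \<epsilon> powr (1 / real l))"
        using B0 CL by (subst ennreal_mult[symmetric]) (auto simp: mult.assoc)
      finally show ?thesis .
    qed
    have R: "(\<integral>\<^sup>+x. ennreal (norm (k (x, \<theta>))) \<partial>lborel) \<le> ennreal (B * CR * \<epsilon> powr (1 / real r))" for \<theta>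
    proof -
      have "(\<integral>\<^sup>+x. ennreal (norm (k (x, \<theta>))) \<partial>lborel) \<le> (\<integral>\<^sup>+x. ennreal B * indicator ?E (x, \<theta>) \<partial>lborel)"
        by (intro nn_integral_mono k_le)
      also have "\<dots> = (\<integral>\<^sup>+x. ennreal B * indicator {x. (x, \<theta>) \<in> ?E} x \<partial>lborel)"
        by (simp add: indicator_def)
      also have "\<dots> = ennreal B * emeasure lborel {x. (x, \<theta>) \<in> ?E}"
        by (intro nn_integral_cmult_indicator) measurable
      also have "\<dots> \<le> ennreal B * ennreal (CR * \<epsilon> powr (1 / real r))"
        using CR(2)[OF \<epsilon>, of \<theta>] by (intro mult_left_mono) auto
      also have "\<dots> = ennreal (B * CR * \<epsilon> powr (1 / real r))"
        using B0 CR by (subst ennreal_mult[symmetric]) (auto simp: mult.assoc)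
      finally show ?thesis .
    qed
    show ?thesis
      unfolding osc using kernel_op_measurable L1_kernel_op_le[OF _ R] Linf_kernel_op_le[OF _ L]
      by (intro conjI op_norm_leI) auto
  qed
  show ?thesis
  proof (intro exI[of _ "B * CR + B * CL"] conjI allI impI ballI)
    fix lam \<epsilon> t :: real assume \<epsilon>: "\<epsilon> > 0" "t \<in> {\<epsilon>, -\<epsilon>}"
    have "B * CR * \<epsilon> powr (1 / real r) \<le> (B * CR + B * CL) * \<epsilon> powr (1 / real r)"
      "B * CL * \<epsilon> powr (1 / real l) \<le> (B * CR + B * CL) * \<epsilon> powr (1 / real l)"
      using B0 CL CR by (auto intro!: mult_right_mono)
    then show "op_norm L1_norm (osc_op S \<psi> \<beta> lam t) \<le> ennreal ((B * CR + B * CL) * \<epsilon> powr (1 / real r))"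
      "op_norm Linf_norm (osc_op S \<psi> \<beta> lam t) \<le> ennreal ((B * CR + B * CL) * \<epsilon> powr (1 / real l))"
      using main[OF \<epsilon>, of lam] by (meson ennreal_leI order_trans)+
  qed (use B0 CL CR in auto)
qed

theorem theorem1p2:
  fixes S :: "(real^'n) \<times> (real^'n) \<Rightarrow> real"
    and \<psi> :: "(real^'n) \<times> (real^'n) \<Rightarrow> complex"
    and \<beta> \<beta>bar :: "real \<Rightarrow> complex"
    and l r :: nat
  assumes "smooth_on UNIV S"
    and "smooth_on UNIV \<psi>" and "compact (supp \<psi>)"
    and "smooth_on UNIV \<beta>" and "supp \<beta> \<subseteq> {1/2..2}"
    and "smooth_on UNIV \<beta>bar" and "supp \<beta>bar \<subseteq> {-2..2}"
    and "\<forall>p. rank (mixed_hessian S p) \<ge> CARD('n) - 1"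
    and "l \<ge> 1" and "r \<ge> 1"
    and "map_type_le (proj_L S) l"
    and "map_type_le (proj_R S) r"
  shows "\<exists>C::real. C \<ge> 0 \<and> (\<forall>lam::real. \<forall>\<epsilon>::real. lam \<ge> 1 \<and> \<epsilon> > 0 \<longrightarrow>
      (\<forall>t\<in>{\<epsilon>, -\<epsilon>}.
         op_norm L1_norm (osc_op S \<psi> \<beta> lam t) \<le> ennreal (C * \<epsilon> powr (1 / real r)) \<and>
         op_norm Linf_norm (osc_op S \<psi> \<beta> lam t) \<le> ennreal (C * \<epsilon> powr (1 / real l))) \<and>
      op_norm L1_norm (osc_op S \<psi> \<beta>bar lam \<epsilon>) \<le> ennreal (C * \<epsilon> powr (1 / real r)) \<and>
      op_norm Linf_norm (osc_op S \<psi> \<beta>bar lam \<epsilon>) \<le> ennreal (C * \<epsilon> powr (1 / real l)))"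
proof -
  \<comment> \<open>Both cutoffs now fall under the same estimate, and the larger of the two
    constants serves for all bounds.\<close>
  have "supp \<beta> \<subseteq> {-2..2}" using assms(5) by force
  then obtain C1 where C1: "C1 \<ge> 0" "\<And>lam \<epsilon> t. \<epsilon> > 0 \<Longrightarrow> t \<in> {\<epsilon>, -\<epsilon>} \<Longrightarrow>
      op_norm L1_norm (osc_op S \<psi> \<beta> lam t) \<le> ennreal (C1 * \<epsilon> powr (1 / real r)) \<and>
      op_norm Linf_norm (osc_op S \<psi> \<beta> lam t) \<le> ennreal (C1 * \<epsilon> powr (1 / real l))"
    using osc_op_bounds[OF assms(1-4) _ assms(8-12)] by blast
  obtain C2 where C2: "C2 \<ge> 0" "\<And>lam \<epsilon> t. \<epsilon> > 0 \<Longrightarrow> t \<in> {\<epsilon>, -\<epsilon>} \<Longrightarrow>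
      op_norm L1_norm (osc_op S \<psi> \<beta>bar lam t) \<le> ennreal (C2 * \<epsilon> powr (1 / real r)) \<and>
      op_norm Linf_norm (osc_op S \<psi> \<beta>bar lam t) \<le> ennreal (C2 * \<epsilon> powr (1 / real l))"
    using osc_op_bounds[OF assms(1-3,6-12)] by blast
  have mono: "ennreal (C1 * \<epsilon> powr a) \<le> ennreal (max C1 C2 * \<epsilon> powr a)"
    "ennreal (C2 * \<epsilon> powr a) \<le> ennreal (max C1 C2 * \<epsilon> powr a)" for \<epsilon> a :: real
    by (auto intro!: ennreal_leI mult_right_mono)
  show ?thesis
  proof (intro exI[of _ "max C1 C2"] conjI allI impI ballI)
    fix lam \<epsilon> t :: real assume "lam \<ge> 1 \<and> \<epsilon> > 0" "t \<in> {\<epsilon>, -\<epsilon>}"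
    then show "op_norm L1_norm (osc_op S \<psi> \<beta> lam t) \<le> ennreal (max C1 C2 * \<epsilon> powr (1 / real r))"
      "op_norm Linf_norm (osc_op S \<psi> \<beta> lam t) \<le> ennreal (max C1 C2 * \<epsilon> powr (1 / real l))"
      using C1(2)[of \<epsilon> t lam] mono(1) order_trans by blast+
  next
    fix lam \<epsilon> :: real assume "lam \<ge> 1 \<and> \<epsilon> > 0"
    then show "op_norm L1_norm (osc_op S \<psi> \<beta>bar lam \<epsilon>) \<le> ennreal (max C1 C2 * \<epsilon> powr (1 / real r))"
      "op_norm Linf_norm (osc_op S \<psi> \<beta>bar lam \<epsilon>) \<le> ennreal (max C1 C2 * \<epsilon> powr (1 / real l))"
      using C2(2)[of \<epsilon> \<epsilon> lam] mono(2) order_trans by blast+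
  qed (use C1 in auto)
qed

end
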